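(* Every finite dimensional $MU_{\mathbf{v}}(2)$-module decomposes as a direct sum of simple modules.
   Context: $\mathbf{v}$ is an indeterminate and $[2]=\mathbf{v}+\mathbf{v}^{-1}$. Mirabolic quantum $\mathfrak{sl}_2$, denoted $MU_{\mathbf{v}}(2)$, is the unital associative $\mathbb{C}(\mathbf{v})$-algebra with generators $e,f,k,k^{-1},\ell$ and relations $kk^{-1}=k^{-1}k=1$; $kek^{-1}=\mathbf{v}^2e$; $kfk^{-1}=\mathbf{v}^{-2}f$; $ef-fe=\frac{k-k^{-1}}{\mathbf{v}-\mathbf{v}^{-1}}$; $\ell^2=\ell$; $k\ell=\ell k$; $\ell e\ell=\ell e$; $\ell f\ell=f\ell$; $[2]e\ell e=\mathbf{v}^{-1}e^2\ell+\mathbf{v}\ell e^2$; $[2]f\ell f=\mathbf{v}^{-1}\ell f^2+\mathbf{v}f^2\ell$. Modules are left modules, and dimension is over $\mathbb{C}(\mathbf{v})$. *)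

theory Defs
  imports
    "HOL-Library.Poly_Mapping"
    "HOL-Library.FuncSet"
    "HOL-Computational_Algebra.Polynomial"
    "HOL-Computational_Algebra.Fraction_Field"
begin

type_synonym ratfun = "complex poly fract"

definition qv :: ratfun where
  "qv = Fract [:0, 1:] 1"

definition q2 :: ratfun where
  "q2 = qv + inverse qv"

datatype mgen = GE | GF | GK | GKinv | GL

text \<open>Words are the free monoid on the generators, written additively because the product
  of polynomial mappings convolves along the addition of the index type.  Hence
  \<open>mword \<Rightarrow>\<^sub>0 ratfun\<close> is the free unital associative algebra on the generators.\<close>

datatype mword = Word "mgen list"

instantiation mword :: monoid_add
begin

definition zero_mword :: mword where
  "0 = Word []"

fun plus_mword :: "mword \<Rightarrow> mword \<Rightarrow> mword" where
  "Word xs + Word ys = Word (xs @ ys)"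

instance
proof
  fix a b c :: mword
  show "a + b + c = a + (b + c)" by (cases a; cases b; cases c) simp
  show "0 + a = a" by (cases a) (simp add: zero_mword_def)
  show "a + 0 = a" by (cases a) (simp add: zero_mword_def)
qed

end

type_synonym mfree = "mword \<Rightarrow>\<^sub>0 ratfun"

definition fgen :: "mgen \<Rightarrow> mfree" where
  "fgen g = Poly_Mapping.single (Word [g]) 1"

definition fscalar :: "ratfun \<Rightarrow> mfree" where
  "fscalar c = Poly_Mapping.single 0 c"

text \<open>\<open>mrel x y\<close> is the defining relation \<open>x = y\<close>.\<close>

inductive mrel :: "mfree \<Rightarrow> mfree \<Rightarrow> bool" where
  k_kinv: "mrel (fgen GK * fgen GKinv) 1"
| kinv_k: "mrel (fgen GKinv * fgen GK) 1"
| k_e: "mrel (fgen GK * fgen GE * fgen GKinv) (fscalar (qv\<^sup>2) * fgen GE)"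
| k_f: "mrel (fgen GK * fgen GF * fgen GKinv) (fscalar (inverse (qv\<^sup>2)) * fgen GF)"
| e_f: "mrel (fgen GE * fgen GF - fgen GF * fgen GE)
          (fscalar (inverse (qv - inverse qv)) * (fgen GK - fgen GKinv))"
| l_l: "mrel ((fgen GL)\<^sup>2) (fgen GL)"
| k_l: "mrel (fgen GK * fgen GL) (fgen GL * fgen GK)"
| l_e_l: "mrel (fgen GL * fgen GE * fgen GL) (fgen GL * fgen GE)"
| l_f_l: "mrel (fgen GL * fgen GF * fgen GL) (fgen GF * fgen GL)"
| e_l_e: "mrel (fscalar q2 * (fgen GE * fgen GL * fgen GE))
          (fscalar (inverse qv) * ((fgen GE)\<^sup>2 * fgen GL) + fscalar qv * (fgen GL * (fgen GE)\<^sup>2))"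
| f_l_f: "mrel (fscalar q2 * (fgen GF * fgen GL * fgen GF))
          (fscalar (inverse qv) * (fgen GL * (fgen GF)\<^sup>2) + fscalar qv * ((fgen GF)\<^sup>2 * fgen GL))"

text \<open>The two-sided ideal generated by the relations.  It is closed under multiplication by
  scalars because these lie in \<^typ>\<open>mfree\<close>.\<close>

inductive_set mideal :: "mfree set" where
  rel: "mrel x y \<Longrightarrow> x - y \<in> mideal"
| zero: "0 \<in> mideal"
| add: "a \<in> mideal \<Longrightarrow> b \<in> mideal \<Longrightarrow> a + b \<in> mideal"
| left: "a \<in> mideal \<Longrightarrow> r * a \<in> mideal"
| right: "a \<in> mideal \<Longrightarrow> a * r \<in> mideal"

lemma mideal_uminus: "a \<in> mideal \<Longrightarrow> - a \<in> mideal"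
  using mideal.left[of a "- 1"] by simp

text \<open>The ideal is proper: it lies in the kernel of the character
  \<open>e, f, \<ell> \<mapsto> 0\<close>, \<open>k, k\<^sup>-\<^sup>1 \<mapsto> 1\<close>.\<close>

fun wchar :: "mword \<Rightarrow> ratfun" where
  "wchar (Word xs) = (if set xs \<subseteq> {GK, GKinv} then 1 else 0)"

lemma wchar_add: "wchar (a + b) = wchar a * wchar b"
  by (cases a; cases b) auto

lemma wchar_zero: "wchar 0 = 1"
  by (simp add: zero_mword_def)

definition fchar :: "mfree \<Rightarrow> ratfun" where
  "fchar p = Sum_any (\<lambda>w. Poly_Mapping.lookup p w * wchar w)"

lemma fchar_add: "fchar (p + q) = fchar p + fchar q"
proof -
  have fin: "finite {w. Poly_Mapping.lookup r w * wchar w \<noteq> 0}" for r :: mfree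
    by (rule finite_subset[OF _ finite_lookup[of r]]) auto
  show ?thesis
    unfolding fchar_def lookup_add distrib_right by (rule Sum_any.distrib) (rule fin)+
qed

lemma fchar_single: "fchar (Poly_Mapping.single w c) = c * wchar w"
proof -
  have "fchar (Poly_Mapping.single w c) = (\<Sum>u\<in>{w}. Poly_Mapping.lookup (Poly_Mapping.single w c) u * wchar u)"
    unfolding fchar_def
    by (rule Sum_any.expand_superset) (auto simp: lookup_single when_def)
  then show ?thesis by simp
qed

lemma fchar_zero: "fchar 0 = 0"
  by (simp add: fchar_def)

lemma mfree_induct [case_names zero add]:
  assumes "P 0" and "\<And>p w c. P p \<Longrightarrow> P (p + Poly_Mapping.single w c)"
  shows "P (p :: mfree)"
proof (induction p rule: update_induct)
  case const
  then show ?case by (rule assms(1))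
next
  case (update p w c)
  have "Poly_Mapping.update w c p = p + Poly_Mapping.single w c"
    using update(1)
    by (intro poly_mapping_eqI)
      (auto simp: lookup_update lookup_add lookup_single when_def in_keys_iff)
  then show ?case using assms(2) update by simp
qed

lemma fchar_mult: "fchar (p * q) = fchar p * fchar q"
proof (induction p rule: mfree_induct)
  case zero
  then show ?case by (simp add: fchar_zero)
next
  case (add p w c)
  have "fchar (Poly_Mapping.single w c * q) = c * wchar w * fchar q"
    by (induction q rule: mfree_induct)
      (simp_all add: fchar_zero fchar_add distrib_left mult_single fchar_single wchar_add)
  with add show ?case by (simp add: fchar_add distrib_right fchar_single)
qed

lemma fchar_one: "fchar 1 = 1"
  by (simp flip: single_one add: fchar_single wchar_zero)

lemma fchar_diff: "fchar (p - q) = fchar p - fchar q"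
  using fchar_add[of "p - q" q] by (simp add: algebra_simps)

lemma fchar_mideal: "a \<in> mideal \<Longrightarrow> fchar a = 0"
proof (induction rule: mideal.induct)
  case (rel x y)
  then show ?case
    by (cases rule: mrel.cases)
      (simp_all add: fchar_diff fchar_mult fchar_add fchar_one fchar_single fgen_def fscalar_def
        power2_eq_square wchar_zero)
qed (simp_all add: fchar_zero fchar_add fchar_mult)

lemma one_notin_mideal: "1 \<notin> mideal"
  using fchar_mideal[of 1] fchar_one by auto

definition mcong :: "mfree \<Rightarrow> mfree \<Rightarrow> bool" where
  "mcong x y \<longleftrightarrow> x - y \<in> mideal"

quotient_type MU = mfree / mcong
proof (rule equivpI)
  show "reflp mcong" by (rule reflpI) (simp add: mcong_def mideal.zero)
  show "symp mcong"
  proof (rule sympI)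
    fix x y assume "mcong x y"
    then show "mcong y x" unfolding mcong_def using mideal_uminus[of "x - y"] by simp
  qed
  show "transp mcong"
  proof (rule transpI)
    fix x y z assume "mcong x y" "mcong y z"
    then show "mcong x z" unfolding mcong_def using mideal.add[of "x - y" "y - z"] by simp
  qed
qed

instantiation MU :: ring_1
begin

lift_definition zero_MU :: MU is 0 .
lift_definition one_MU :: MU is 1 .

lift_definition plus_MU :: "MU \<Rightarrow> MU \<Rightarrow> MU" is "(+)"
  unfolding mcong_def by (metis add_diff_add mideal.add)

lift_definition uminus_MU :: "MU \<Rightarrow> MU" is uminus
  unfolding mcong_def by (metis mideal_uminus minus_diff_minus)

lift_definition minus_MU :: "MU \<Rightarrow> MU \<Rightarrow> MU" is "(-)"
proof -
  fix a a' b b' :: mfree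
  assume "mcong a a'" "mcong b b'"
  then have "(a - a') + - (b - b') \<in> mideal"
    unfolding mcong_def by (intro mideal.add mideal_uminus)
  then show "mcong (a - b) (a' - b')"
    unfolding mcong_def by (simp add: algebra_simps)
qed

lift_definition times_MU :: "MU \<Rightarrow> MU \<Rightarrow> MU" is "(*)"
proof -
  fix a a' b b' :: mfree
  assume "mcong a a'" "mcong b b'"
  then have "(a - a') * b + a' * (b - b') \<in> mideal"
    unfolding mcong_def by (intro mideal.add mideal.left mideal.right)
  then show "mcong (a * b) (a' * b')"
    unfolding mcong_def by (simp add: algebra_simps)
qed

instance
proof
  fix a b c :: MU
  show "a + b + c = a + (b + c)" by transfer (simp add: mcong_def mideal.zero algebra_simps)
  show "a + b = b + a" by transfer (simp add: mcong_def mideal.zero algebra_simps)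
  show "0 + a = a" by transfer (simp add: mcong_def mideal.zero)
  show "- a + a = 0" by transfer (simp add: mcong_def mideal.zero)
  show "a - b = a + - b" by transfer (simp add: mcong_def mideal.zero)
  show "a * b * c = a * (b * c)" by transfer (simp add: mcong_def mideal.zero algebra_simps)
  show "(a + b) * c = a * c + b * c" by transfer (simp add: mcong_def mideal.zero algebra_simps)
  show "a * (b + c) = a * b + a * c" by transfer (simp add: mcong_def mideal.zero algebra_simps)
  show "1 * a = a" by transfer (simp add: mcong_def mideal.zero)
  show "a * 1 = a" by transfer (simp add: mcong_def mideal.zero)
  show "(0 :: MU) \<noteq> 1"
    by transfer (use one_notin_mideal mideal_uminus[of "- 1"] in \<open>auto simp: mcong_def\<close>)
qed

end

text \<open>The structure map of the \<^typ>\<open>ratfun\<close>-algebra \<^typ>\<open>MU\<close>.\<close>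

lift_definition MU_scalar :: "ratfun \<Rightarrow> MU" is fscalar .

lift_definition MU_gen :: "mgen \<Rightarrow> MU" is fgen .

text \<open>The library's \<^locale>\<open>module\<close> is restricted to commutative rings.\<close>

locale left_module =
  fixes act :: "'r::ring_1 \<Rightarrow> 'b::ab_group_add \<Rightarrow> 'b"
  assumes act_add_right: "act a (x + y) = act a x + act a y"
    and act_add_left: "act (a + b) x = act a x + act b x"
    and act_act: "act a (act b x) = act (a * b) x"
    and act_one: "act 1 x = x"

definition submodule :: "('r::ring_1 \<Rightarrow> 'b::ab_group_add \<Rightarrow> 'b) \<Rightarrow> 'b set \<Rightarrow> bool" where
  "submodule act W \<longleftrightarrow>
     0 \<in> W \<and> (\<forall>x\<in>W. \<forall>y\<in>W. x + y \<in> W) \<and> (\<forall>a. \<forall>x\<in>W. act a x \<in> W)"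

definition simple_submodule :: "('r::ring_1 \<Rightarrow> 'b::ab_group_add \<Rightarrow> 'b) \<Rightarrow> 'b set \<Rightarrow> bool" where
  "simple_submodule act W \<longleftrightarrow>
     submodule act W \<and> W \<noteq> {0} \<and>
     (\<forall>U. submodule act U \<and> U \<subseteq> W \<longrightarrow> U = {0} \<or> U = W)"

text \<open>Internal direct sum of a finite family; the empty family sums to the zero module.\<close>

definition is_direct_sum :: "'i set \<Rightarrow> ('i \<Rightarrow> 'b::ab_group_add set) \<Rightarrow> bool" where
  "is_direct_sum I W \<longleftrightarrow> finite I \<and> (\<forall>x. \<exists>!c. c \<in> (\<Pi>\<^sub>E i\<in>I. W i) \<and> x = (\<Sum>i\<in>I. c i))"

text \<open>The action of \<^typ>\<open>ratfun\<close> on an \<^typ>\<open>MU\<close>-module is through \<^const>\<open>MU_scalar\<close>.\<close>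

definition finite_dim :: "(MU \<Rightarrow> 'b::ab_group_add \<Rightarrow> 'b) \<Rightarrow> bool" where
  "finite_dim act \<longleftrightarrow> (\<exists>B. finite_dimensional_vector_space (\<lambda>c. act (MU_scalar c)) B)"

end

theory Submission
  imports Defs
begin

text \<open>
  Let \<open>V\<close> be a finite-dimensional module and \<open>t = v\<^sup>2\<close>.  The operators \<open>e\<close> and \<open>f\<close> are nilpotent, since
  conjugation by \<open>k\<close> multiplies them by \<open>t\<close> and \<open>t\<^sup>-\<^sup>1\<close>, which are not roots of unity
  (\<open>nilpotent_if_rescaled\<close>).

  The idempotent \<open>\<ell>\<close> splits \<open>V\<close> into its image and its kernel.  The relations \<open>\<ell>e\<ell> = \<ell>e\<close> and
  \<open>\<ell>f\<ell> = f\<ell>\<close> make \<open>e\<close> and \<open>f\<close> block triangular: \<open>e = E + a\<close> and \<open>f = F + b\<close>, where \<open>E\<close> and \<open>F\<close> preserve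
  both blocks, \<open>a\<close> maps the image to the kernel and \<open>b\<close> the kernel to the image.  In terms of the blocks
  the other relations become \<open>E a = t a E\<close>, \<open>b F = t F b\<close>, \<open>E b = b E\<close>, \<open>F a = a F\<close> and
  \<open>E F - F E = (k - G k\<^sup>-\<^sup>1) / (v - v\<^sup>-\<^sup>1)\<close>, where \<open>G = 1 + (v - v\<^sup>-\<^sup>1) (a b - b a) k\<close> commutes with \<open>E\<close>, \<open>F\<close>,
  \<open>k\<close> and \<open>\<ell>\<close>.  So each block is a representation of a twisted form of quantum \<open>sl\<^sub>2\<close>.

  For such a twisted form the usual theory of highest weights goes through: \<open>V\<close> is spanned by strings
  \<open>h, F h, F\<^sup>2 h, \<dots>\<close>, where \<open>h\<close> is a common eigenvector of \<open>k\<close> and \<open>G\<close> in the kernel of \<open>E\<close>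
  (\<open>span_strings\<close>).  The general statement is used twice.  Applied to \<open>e\<close>, \<open>f\<close>, \<open>k\<close> with the trivial
  twist it shows that \<open>k\<close> is diagonalizable; this is what is needed to apply it to \<open>E\<close>, \<open>F\<close>, \<open>k\<close>, \<open>G\<close>.

  Let \<open>S\<close> be the span of a string that lies in one block, with \<open>G = g\<close> on \<open>S\<close>, and let \<open>d\<close> be the one of \<open>a\<close>, \<open>b\<close>
  that leaves this block, \<open>d'\<close> the other one.  Then \<open>S + d S\<close> is a submodule.  By the formula for \<open>G\<close>, the product
  \<open>d' d\<close> acts on \<open>S\<close> as a multiple of \<open>k\<^sup>-\<^sup>1\<close>, by a scalar that vanishes only for \<open>g = 1\<close>.  If \<open>g \<noteq> 1\<close>, then
  \<open>d S\<close> can be moved back to \<open>S\<close>, and \<open>S + d S\<close> is simple because \<open>S\<close> is generated under \<open>E\<close> and \<open>F\<close>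
  by any of its non-zero vectors.  If \<open>g = 1\<close>, the length of a string is determined by its highest weight,
  and comparing the strings of \<open>h\<close> and \<open>d h\<close> shows \<open>d h = 0\<close>, so that \<open>S + d S = S\<close>
  (\<open>block_hw_vector_simple\<close>).  Hence \<open>V\<close> is a sum of simple submodules, and finitely many of them form a
  direct sum equal to \<open>V\<close> (\<open>direct_family_of_simples\<close>).
\<close>

section \<open>Eigenvectors and annihilating polynomials of endomorphisms\<close>

abbreviation endo :: "('a::comm_ring_1 \<Rightarrow> 'b::ab_group_add \<Rightarrow> 'b) \<Rightarrow> ('b \<Rightarrow> 'b) \<Rightarrow> bool" where
  "endo scale T \<equiv> module_hom scale scale T"

text \<open>The Horner form makes the rule for \<^const>\<open>pCons\<close> immediate, so that the algebra of
  such operators \<open>p(T)\<close> follows by induction over the coefficients.\<close>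

definition poly_act ::
    "('a::comm_ring_1 \<Rightarrow> 'b::ab_group_add \<Rightarrow> 'b) \<Rightarrow> ('b \<Rightarrow> 'b) \<Rightarrow> 'a poly \<Rightarrow> 'b \<Rightarrow> 'b" where
  "poly_act scale T p = fold_coeffs (\<lambda>a g x. scale a x + T (g x)) p (\<lambda>x. 0)"

context vector_space
begin

lemma endo_funpow:
  assumes "endo scale T"
  shows "endo scale (T ^^ n)"
proof (induction n)
  case 0
  then show ?case by (simp add: module_hom_iff module_axioms)
next
  case (Suc n)
  then show ?case using assms by (simp add: module_hom_iff)
qed

lemma subspace_vimage_endo:
  assumes "endo scale T" "subspace Y"
  shows "subspace {x. T x \<in> Y}"
  using assms by (auto simp: subspace_def module_hom.add module_hom.scale module_hom.zero)

lemma endo_span_into: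
  assumes "endo scale T" "subspace Y" "\<And>x. x \<in> S \<Longrightarrow> T x \<in> Y" "y \<in> span S"
  shows "T y \<in> Y"
  using span_minimal[OF _ subspace_vimage_endo[OF assms(1,2)], of S] assms(3,4) by auto

text \<open>Solvability of \<open>T x' = x\<close> modulo \<open>Y\<close> is a linear condition on \<open>x\<close>, so it passes from
  generators to their span.\<close>

lemma endo_span_onto:
  assumes T: "endo scale T" and "\<And>x. x \<in> S \<Longrightarrow> \<exists>x'\<in>W. T x' - x \<in> Y"
    and W: "subspace W" and Y: "subspace Y" and "y \<in> span S"
  shows "\<exists>y'\<in>W. T y' - y \<in> Y"
  using assms(5)
proof (induction rule: span_induct)
  case base
  show ?case
  proof (rule subspaceI)
    show "0 \<in> {x. \<exists>x'\<in>W. T x' - x \<in> Y}"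
      using subspace_0[OF W] subspace_0[OF Y] module_hom.zero[OF T] by (auto intro!: bexI[of _ 0])
  next
    fix x y assume "x \<in> {x. \<exists>x'\<in>W. T x' - x \<in> Y}" "y \<in> {x. \<exists>x'\<in>W. T x' - x \<in> Y}"
    then obtain x' y' where *: "x' \<in> W" "y' \<in> W" "T x' - x \<in> Y" "T y' - y \<in> Y" by blast
    have "T (x' + y') - (x + y) = (T x' - x) + (T y' - y)"
      by (simp add: module_hom.add[OF T])
    then show "x + y \<in> {x. \<exists>x'\<in>W. T x' - x \<in> Y}"
      using * subspace_add[OF W] subspace_add[OF Y] by (metis (mono_tags, lifting) mem_Collect_eq)
  next
    fix c x assume "x \<in> {x. \<exists>x'\<in>W. T x' - x \<in> Y}"
    then obtain x' where *: "x' \<in> W" "T x' - x \<in> Y" by blast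
    have "T (c *s x') - c *s x = c *s (T x' - x)"
      by (simp add: module_hom.scale[OF T] scale_right_diff_distrib)
    then show "c *s x \<in> {x. \<exists>x'\<in>W. T x' - x \<in> Y}"
      using * subspace_scale[OF W] subspace_scale[OF Y] by (metis (mono_tags, lifting) mem_Collect_eq)
  qed
next
  case (step x)
  then show ?case using assms(2) by blast
qed

text \<open>The usual Vandermonde argument: applying \<open>T - m\<^sub>0\<close> removes one
  component from the sum and rescales the others by non-zero factors.\<close>

lemma eigencomponents_mem:
  assumes T: "endo scale T" and Y: "subspace Y" "\<And>y. y \<in> Y \<Longrightarrow> T y \<in> Y"
    and "finite M" "\<And>m. m \<in> M \<Longrightarrow> T (x m) = m *s x m" "(\<Sum>m\<in>M. x m) \<in> Y" "m \<in> M"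
  shows "x m \<in> Y"
  using assms(4-)
proof (induction M arbitrary: x m rule: finite_induct)
  case empty
  then show ?case by simp
next
  case (insert m0 M)
  let ?s = "\<Sum>m\<in>insert m0 M. x m"
  have "T ?s = (\<Sum>m\<in>insert m0 M. m *s x m)"
    using insert.prems(1) by (subst module_hom.sum[OF T]) (rule sum.cong; simp)
  then have "T ?s - m0 *s ?s = (\<Sum>m\<in>M. (m - m0) *s x m)"
    using insert.hyps
    by (simp add: scale_sum_right sum_subtractf[symmetric] scale_left_diff_distrib scale_right_distrib)
  then have "(\<Sum>m\<in>M. (m - m0) *s x m) \<in> Y"
    using insert.prems(2) Y(2) subspace_diff[OF Y(1)] subspace_scale[OF Y(1)] by metis
  then have *: "(m - m0) *s x m \<in> Y" if "m \<in> M" for m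
    using insert.IH[of "\<lambda>m. (m - m0) *s x m"] insert.prems(1) that
    by (simp add: module_hom.scale[OF T] mult.commute)
  have M: "x m \<in> Y" if "m \<in> M" for m
  proof -
    have "m - m0 \<noteq> 0" using that insert.hyps by auto
    then have "inverse (m - m0) *s ((m - m0) *s x m) = x m" by simp
    then show ?thesis using *[OF that] subspace_scale[OF Y(1)] by metis
  qed
  have "x m0 = ?s - (\<Sum>m\<in>M. x m)" using insert.hyps by simp
  also have "\<dots> \<in> Y"
    by (intro subspace_diff[OF Y(1)] subspace_sum[OF Y(1)] M insert.prems(2))
  finally show ?case using M insert.prems(3) by blast
qed

lemma span_eigenvectors_decomp:
  assumes "w \<in> span S" "\<And>x. x \<in> S \<Longrightarrow> \<exists>m. T x = m *s x"
  obtains M x where "finite M" "w = (\<Sum>m\<in>M. x m)" "\<And>m. x m \<in> span {y\<in>S. T y = m *s y}"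
proof -
  from assms(1) obtain B c where B: "finite B" "B \<subseteq> S" "w = (\<Sum>b\<in>B. c b *s b)"
    unfolding span_explicit by blast
  obtain f where f: "\<And>x. x \<in> S \<Longrightarrow> T x = f x *s x" using assms(2) by metis
  let ?x = "\<lambda>m. \<Sum>b\<in>{b\<in>B. f b = m}. c b *s b"
  have "w = (\<Sum>m\<in>f ` B. ?x m)" using B by (simp add: sum.image_gen[of B _ f])
  moreover have "?x m \<in> span {y\<in>S. T y = m *s y}" for m
    using B(2) f by (intro span_sum span_scale span_base) auto
  ultimately show thesis using that B(1) by blast
qed

lemma eigenvector_span:
  assumes T: "endo scale T" and "x \<in> span {y\<in>S. T y = m *s y}"
  shows "T x = m *s x"
proof -
  interpret module_hom scale scale T by (fact T)
  show ?thesis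
    using assms(2)
    by (induction rule: span_induct)
      (auto simp: subspace_def add scale scale_right_distrib mult.commute)
qed

text \<open>The operator \<open>T - l\<close> multiplies the component of \<open>w\<close> for the eigenvalue \<open>m\<close> by \<open>m - l\<close>, which can be
  cancelled for \<open>m \<noteq> l\<close>; so the components for these \<open>m\<close> are in \<open>Y\<close>.\<close>

lemma eigencomponent_mod:
  assumes T: "endo scale T" and Y: "subspace Y" "\<And>y. y \<in> Y \<Longrightarrow> T y \<in> Y"
    and S: "\<And>x. x \<in> S \<Longrightarrow> \<exists>m. T x = m *s x"
    and w: "w \<in> span S" "T w - l *s w \<in> Y"
  obtains w' where "w' \<in> span {x\<in>S. T x = l *s x}" "w - w' \<in> Y"
proof -
  obtain M x where x: "finite M" "w = (\<Sum>m\<in>M. x m)" "\<And>m. x m \<in> span {y\<in>S. T y = m *s y}"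
    using span_eigenvectors_decomp[OF w(1) S] by blast
  have Tx: "T (x m) = m *s x m" for m by (rule eigenvector_span[OF T x(3)])
  have "T w - l *s w = (\<Sum>m\<in>M. (m - l) *s x m)"
    unfolding x(2) module_hom.sum[OF T]
    by (simp add: Tx scale_sum_right sum_subtractf scale_left_diff_distrib)
  with w(2) have "(\<Sum>m\<in>M. (m - l) *s x m) \<in> Y" by simp
  then have *: "(m - l) *s x m \<in> Y" if "m \<in> M" for m
    using eigencomponents_mem[OF T Y x(1), of "\<lambda>m. (m - l) *s x m"] that
    by (simp add: module_hom.scale[OF T] Tx mult.commute)
  have M: "x m \<in> Y" if "m \<in> M - {l}" for m
  proof -
    have "inverse (m - l) *s ((m - l) *s x m) = x m" using that by simp
    then show ?thesis using * that subspace_scale[OF Y(1)] by (metis DiffD1)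
  qed
  let ?w = "if l \<in> M then x l else 0"
  have "w - ?w = (\<Sum>m\<in>M-{l}. x m)"
    unfolding x(2) using x(1) by (auto simp: sum_diff1)
  also have "\<dots> \<in> Y" by (intro subspace_sum[OF Y(1)] M)
  finally show thesis using that[of ?w] x(3)[of l] by (auto simp: span_zero)
qed

lemma span_eigenvectors_subspace:
  assumes T: "endo scale T" and X: "subspace X" "\<And>y. y \<in> X \<Longrightarrow> T y \<in> X"
    and w: "w \<in> X" "w \<in> span {x. \<exists>m. T x = m *s x}"
  shows "w \<in> span {x\<in>X. \<exists>m. T x = m *s x}"
proof -
  obtain M x where x: "finite M" "w = (\<Sum>m\<in>M. x m)"
      "\<And>m. x m \<in> span {y\<in>{x. \<exists>m. T x = m *s x}. T y = m *s y}"
    using span_eigenvectors_decomp[OF w(2), of T] by blast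
  have Tx: "T (x m) = m *s x m" for m by (rule eigenvector_span[OF T x(3)])
  then have "x m \<in> X" if "m \<in> M" for m
    using eigencomponents_mem[OF T X x(1)] that w(1) x(2) by metis
  with Tx show ?thesis unfolding x(2) by (intro span_sum span_base) auto
qed

text \<open>One step in showing that an operator annihilated by a product of distinct linear factors is
  diagonalizable: as \<open>m\<close> differs from the eigenvalues in \<open>M\<close>, the operator \<open>T - m\<close> can be inverted
  on the span of the eigenvectors for \<open>M\<close>, and what remains of \<open>y\<close> is an eigenvector for \<open>m\<close>.
  Everything is modulo \<open>Y\<close>; the vectors of \<open>Y\<close> themselves count as eigenvectors for the case of an
  empty set \<open>M\<close>.\<close>

lemma span_eigenvectors_mod_step:
  assumes T: "endo scale T" and Y: "subspace Y" "\<And>y. y \<in> Y \<Longrightarrow> T y \<in> Y"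
    and X: "subspace X"
    and m: "m \<notin> M" and y: "y \<in> X" "T y - m *s y \<in> span {x\<in>X. x \<in> Y \<or> (\<exists>l\<in>M. T x - l *s x \<in> Y)}"
  shows "y \<in> span {x\<in>X. x \<in> Y \<or> (\<exists>l\<in>insert m M. T x - l *s x \<in> Y)}"
proof -
  let ?S = "{x\<in>X. x \<in> Y \<or> (\<exists>l\<in>M. T x - l *s x \<in> Y)}"
  interpret T: module_hom scale scale T by (fact T)
  have T': "endo scale (\<lambda>x. T x - m *s x)"
    by unfold_locales (simp_all add: T.add T.scale algebra_simps scale_right_diff_distrib)
  have "\<exists>y'\<in>span ?S. (T y' - m *s y') - (T y - m *s y) \<in> Y"
  proof (rule endo_span_onto[OF T' _ subspace_span Y(1) y(2)])
    fix x assume "x \<in> ?S"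
    then consider "x \<in> Y" | l where "x \<in> X" "l \<in> M" "T x - l *s x \<in> Y" by blast
    then show "\<exists>x'\<in>span ?S. (T x' - m *s x') - x \<in> Y"
    proof cases
      case 1
      then show ?thesis using subspace_neg[OF Y(1)] by (intro bexI[of _ 0]) (simp_all add: span_zero)
    next
      case l: (2 l)
    with m have "l - m \<noteq> 0" by auto
    define x' where "x' = inverse (l - m) *s x"
    have "x' \<in> span ?S" unfolding x'_def using \<open>x \<in> ?S\<close> by (intro span_scale span_base)
    moreover have "(l - m) *s x' = x" using \<open>l - m \<noteq> 0\<close> by (simp add: x'_def)
    then have "(T x' - m *s x') - x = inverse (l - m) *s (T x - l *s x)"
      by (metis (no_types, lifting) T.scale add_diff_cancel_left' diff_diff_eq2 diff_add_cancel
          scale_left_diff_distrib scale_left_commute scale_right_diff_distrib x'_def diff_diff_add)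
    then have "(T x' - m *s x') - x \<in> Y" using l(3) subspace_scale[OF Y(1)] by metis
    ultimately show ?thesis by blast
    qed
  qed
  then obtain y' where y': "y' \<in> span ?S" "(T y' - m *s y') - (T y - m *s y) \<in> Y" by blast
  have "span ?S \<subseteq> X" using X by (intro span_minimal) auto
  then have "y - y' \<in> X" using y' y(1) subspace_diff[OF X] by blast
  moreover have "T (y - y') - m *s (y - y') = - ((T y' - m *s y') - (T y - m *s y))"
    by (simp add: T.diff scale_right_diff_distrib)
  then have "T (y - y') - m *s (y - y') \<in> Y" using y'(2) subspace_neg[OF Y(1)] by metis
  ultimately have "y - y' \<in> span {x\<in>X. x \<in> Y \<or> (\<exists>l\<in>insert m M. T x - l *s x \<in> Y)}"
    by (intro span_base) auto
  moreover have "y' \<in> span {x\<in>X. x \<in> Y \<or> (\<exists>l\<in>insert m M. T x - l *s x \<in> Y)}"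
    using y'(1) span_mono[of ?S "{x\<in>X. x \<in> Y \<or> (\<exists>l\<in>insert m M. T x - l *s x \<in> Y)}"] by blast
  ultimately show ?thesis using span_add by fastforce
qed

context
  fixes T
  assumes T: "endo scale T"
begin

interpretation T: module_hom scale scale T by (fact T)

lemma poly_act_0: "poly_act scale T 0 x = 0"
  by (simp add: poly_act_def)

lemma poly_act_pCons: "poly_act scale T (pCons a p) x = a *s x + T (poly_act scale T p x)"
  by (cases "p = 0"; cases "a = 0")
    (auto simp: poly_act_def fold_coeffs_pCons_coeff_not_0_eq fold_coeffs_pCons_not_0_0_eq)

lemma poly_act_add: "poly_act scale T (p + q) x = poly_act scale T p x + poly_act scale T q x"
  by (induction p q rule: poly_induct2)
    (simp_all add: poly_act_0 poly_act_pCons T.add scale_left_distrib)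

lemma poly_act_smult: "poly_act scale T (smult c p) x = c *s poly_act scale T p x"
  by (induction p) (simp_all add: poly_act_0 poly_act_pCons T.scale scale_right_distrib)

lemma poly_act_diff: "poly_act scale T (p - q) x = poly_act scale T p x - poly_act scale T q x"
  using poly_act_add[of p "smult (- 1) q"] poly_act_smult[of "- 1" q] by simp

lemma poly_act_mult: "poly_act scale T (p * q) x = poly_act scale T p (poly_act scale T q x)"
  by (induction p) (simp_all add: poly_act_0 poly_act_pCons poly_act_add poly_act_smult)

lemma poly_act_monom: "poly_act scale T (monom c n) x = c *s (T ^^ n) x"
  by (induction n) (simp_all add: monom_0 monom_Suc poly_act_0 poly_act_pCons T.scale)

lemma poly_act_sum: "poly_act scale T (sum p I) x = (\<Sum>i\<in>I. poly_act scale T (p i) x)"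
  by (induction I rule: infinite_finite_induct) (simp_all add: poly_act_0 poly_act_add)

lemma endo_poly_act: "endo scale (poly_act scale T p)"
  by unfold_locales
    (induction p; simp add: poly_act_0 poly_act_pCons T.add T.scale scale_right_distrib mult.commute)+

text \<open>The relation \<open>K T = t T K\<close> turns \<open>p(T)\<close> into \<open>p(t T)\<close> on moving it across \<open>K\<close>.\<close>

lemma poly_act_rescale:
  assumes K: "endo scale K" and KT: "\<And>x. K (T x) = t *s T (K x)"
  shows "poly_act scale T (pcompose p [:0, t:]) (K x) = K (poly_act scale T p x)"
proof -
  interpret K: module_hom scale scale K by (fact K)
  show ?thesis
    by (induction p)
      (simp_all add: poly_act_0 poly_act_pCons pcompose_pCons poly_act_add poly_act_smult
        K.add K.scale KT T.scale)
qed

end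

end

context finite_dimensional_vector_space
begin

lemma annihilating_poly_vector:
  assumes T: "endo scale T"
  obtains p where "p \<noteq> 0" "poly_act scale T p x = 0"
proof (cases "inj_on (\<lambda>i. (T ^^ i) x) {..dimension}")
  case False
  then obtain i j where "i \<noteq> j" "(T ^^ i) x = (T ^^ j) x" unfolding inj_on_def by blast
  then have "poly_act scale T (monom 1 i - monom 1 j) x = 0"
    by (simp add: poly_act_monom[OF T] poly_act_diff[OF T])
  moreover have "coeff (monom 1 i - monom 1 j :: 'a poly) i \<noteq> 0"
    using \<open>i \<noteq> j\<close> by simp
  then have "monom 1 i - monom 1 j \<noteq> (0 :: 'a poly)" by force
  ultimately show thesis using that by blast
next
  case True
  let ?S = "(\<lambda>i. (T ^^ i) x) ` {..dimension}"
  have "card ?S = Suc dimension" using True by (simp add: card_image)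
  moreover have "finite ?S" "?S \<subseteq> span Basis" by (auto simp: span_Basis)
  ultimately have "dependent ?S"
    using independent_span_bound[OF finite_Basis, of ?S] by (force simp: dimension_def)
  then obtain u v where u: "(\<Sum>v\<in>?S. u v *s v) = 0" "v \<in> ?S" "u v \<noteq> 0"
    unfolding dependent_finite[OF finite_imageI[OF finite_atMost]] by blast
  define p where "p = (\<Sum>i\<le>dimension. monom (u ((T ^^ i) x)) i)"
  have "poly_act scale T p x = 0"
    using u(1) True by (simp add: p_def poly_act_sum[OF T] poly_act_monom[OF T] sum.reindex)
  moreover obtain i where i: "i \<le> dimension" "v = (T ^^ i) x" using u(2) by blast
  then have "coeff p i \<noteq> 0" using u(3) by (simp add: p_def coeff_sum when_def)
  then have "p \<noteq> 0" by force
  ultimately show thesis using that by blast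
qed

lemma annihilating_poly:
  assumes T: "endo scale T"
  obtains p where "p \<noteq> 0" "\<And>x. poly_act scale T p x = 0"
proof -
  have "\<exists>p. p \<noteq> 0 \<and> (\<forall>x\<in>B. poly_act scale T p x = 0)" if "finite B" for B
    using that
  proof (induction B rule: finite_induct)
    case empty
    then show ?case by (auto intro: exI[of _ 1])
  next
    case (insert b B)
    then obtain p where p: "p \<noteq> 0" "\<And>x. x \<in> B \<Longrightarrow> poly_act scale T p x = 0" by blast
    obtain q where q: "q \<noteq> 0" "poly_act scale T q (poly_act scale T p b) = 0"
      using annihilating_poly_vector[OF T] .
    have "poly_act scale T (q * p) x = 0" if "x \<in> insert b B" for x
      using that p q module_hom.zero[OF endo_poly_act[OF T]] by (auto simp: poly_act_mult[OF T])
    then show ?case using p q by (intro exI[of _ "q * p"]) auto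
  qed
  from this[OF finite_Basis] obtain p where p: "p \<noteq> 0" "\<And>x. x \<in> Basis \<Longrightarrow> poly_act scale T p x = 0"
    by blast
  have "poly_act scale T p x \<in> {0}" for x
    by (rule endo_span_into[OF endo_poly_act[OF T] _ _ , where S = Basis]) (use p span_Basis in auto)
  with p that show thesis by blast
qed

text \<open>Let \<open>p\<close> be an annihilating polynomial of \<open>T\<close> of least degree \<open>d\<close>.  Since \<open>K\<close> is onto,
  \<open>p(t X)\<close> annihilates \<open>T\<close> too, and \<open>p(t X) - t\<^sup>d p(X)\<close> has smaller degree, so it is zero.  As \<open>t\<close>
  is not a root of unity, only the leading coefficient of \<open>p\<close> survives, and \<open>T\<^sup>d = 0\<close>.  Unlike an
  argument with weight spaces, this works over a field that is not algebraically closed.\<close>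

lemma nilpotent_if_rescaled:
  assumes T: "endo scale T" and K: "endo scale K" and KT: "\<And>x. K (T x) = t *s T (K x)"
    and surj: "\<And>x. \<exists>y. K y = x" and t: "t \<noteq> 0" "\<And>n. n > 0 \<Longrightarrow> t ^ n \<noteq> 1"
  obtains N where "\<And>x. (T ^^ N) x = 0"
proof -
  define P where "P p \<longleftrightarrow> p \<noteq> 0 \<and> (\<forall>x. poly_act scale T p x = 0)" for p
  obtain p0 where "P p0" using annihilating_poly[OF T] unfolding P_def by metis
  then obtain p where p: "P p" "\<And>q. P q \<Longrightarrow> degree p \<le> degree q"
    using ex_has_least_nat[of P p0 degree] by blast
  define d where "d = degree p"
  define q where "q = pcompose p [:0, t:] - smult (t ^ d) p"
  have cq: "coeff q i = (t ^ i - t ^ d) * coeff p i" for i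
    by (simp add: q_def coeff_pcompose_linear algebra_simps)
  have "poly_act scale T q x = 0" for x
  proof -
    obtain y where "x = K y" using surj by metis
    then have "poly_act scale T (pcompose p [:0, t:]) x = 0"
      using p(1) by (simp add: poly_act_rescale[OF T K KT] P_def module_hom.zero[OF K])
    then show ?thesis
      using p(1) unfolding P_def q_def by (simp add: poly_act_diff[OF T] poly_act_smult[OF T])
  qed
  moreover have "degree q < degree p" if "q \<noteq> 0"
  proof (rule ccontr)
    assume *: "\<not> degree q < degree p"
    have "coeff q (degree q) \<noteq> 0" using that by simp
    with * show False unfolding cq by (cases "degree q = d") (auto simp: d_def coeff_eq_0)
  qed
  ultimately have "q = 0" using p(2)[of q] unfolding P_def by (metis linorder_not_less)
  have "coeff p i = 0" if "i \<noteq> d" for i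
  proof (cases "i < d")
    case True
    have "t ^ d = t ^ i * t ^ (d - i)" using True by (simp add: power_add[symmetric])
    then have "t ^ i \<noteq> t ^ d" using t(1) t(2)[of "d - i"] True by auto
    with cq[of i] \<open>q = 0\<close> show ?thesis by simp
  next
    case False
    with that show ?thesis by (simp add: d_def coeff_eq_0)
  qed
  then have "p = monom (coeff p d) d" by (intro poly_eqI) auto
  then have "coeff p d *s (T ^^ d) x = 0" for x
    using p(1) poly_act_monom[OF T, of "coeff p d" d x] unfolding P_def by simp
  moreover have "coeff p d \<noteq> 0" using p(1) by (simp add: P_def d_def)
  ultimately have "(T ^^ d) x = 0" for x by simp
  then show thesis by (rule that)
qed

end

section \<open>Triples of operators of quantum \<open>sl\<^sub>2\<close> type\<close>

text \<open>The relations of quantum \<open>sl\<^sub>2\<close> with \<open>t = v\<^sup>2\<close>, except that \<open>k\<^sup>-\<^sup>1\<close> in the commutator of \<open>E\<close> and \<open>F\<close> is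
  twisted by an operator \<open>G\<close> that commutes with the rest.  The case \<open>G = 1\<close> is quantum \<open>sl\<^sub>2\<close> itself;
  the twisted case is what the diagonal blocks of a mirabolic module satisfy.\<close>

locale quantum_triple = vector_space scale
  for scale :: "'a::field \<Rightarrow> 'b::ab_group_add \<Rightarrow> 'b" (infixr "*s" 75) +
  fixes E F K K' G :: "'b \<Rightarrow> 'b" and t r :: 'a
  assumes endo_E: "endo scale E" and endo_F: "endo scale F" and endo_K: "endo scale K"
    and endo_K': "endo scale K'" and endo_G: "endo scale G"
    and K_K': "K (K' x) = x" and K'_K: "K' (K x) = x"
    and K_E: "K (E x) = t *s E (K x)" and F_K: "F (K x) = t *s K (F x)"
    and E_F: "E (F x) = F (E x) + r *s (K x - G (K' x))"
    and G_E: "G (E x) = E (G x)" and G_F: "G (F x) = F (G x)" and G_K: "G (K x) = K (G x)"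
    and r_nonzero: "r \<noteq> 0" and t_nonzero: "t \<noteq> 0" and t_not_root: "n > 0 \<Longrightarrow> t ^ n \<noteq> 1"
    and E_nilpotent: "\<exists>N. \<forall>x. (E ^^ N) x = 0" and F_nilpotent: "\<exists>N. \<forall>x. (F ^^ N) x = 0"
begin

lemmas E_simps = module_hom.add[OF endo_E] module_hom.diff[OF endo_E] module_hom.scale[OF endo_E]
  module_hom.zero[OF endo_E]
lemmas F_simps = module_hom.add[OF endo_F] module_hom.diff[OF endo_F] module_hom.scale[OF endo_F]
  module_hom.zero[OF endo_F]
lemmas K_simps = module_hom.add[OF endo_K] module_hom.diff[OF endo_K] module_hom.scale[OF endo_K]
  module_hom.zero[OF endo_K]
lemmas K'_simps = module_hom.add[OF endo_K'] module_hom.diff[OF endo_K']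
  module_hom.scale[OF endo_K'] module_hom.zero[OF endo_K']
lemmas G_simps = module_hom.add[OF endo_G] module_hom.diff[OF endo_G] module_hom.scale[OF endo_G]
  module_hom.zero[OF endo_G]

lemma scale_cancel: "c \<noteq> 0 \<Longrightarrow> c *s x = c *s y \<Longrightarrow> x = y"
  by (metis scale_cancel_left)

lemma K'_F: "K' (F x) = t *s F (K' x)"
proof -
  have "K (K' (F x)) = K (t *s F (K' x))"
    using F_K[of "K' x"] by (simp add: K_K' K_simps)
  then show ?thesis by (metis K'_K)
qed

lemma G_K': "G (K' x) = K' (G x)"
  by (metis G_K K_K' K'_K)

lemma K_F_funpow: "(F ^^ n) (K x) = t ^ n *s K ((F ^^ n) x)"
  by (induction n) (simp_all add: F_simps F_K)

lemma G_F_funpow: "G ((F ^^ n) x) = (F ^^ n) (G x)"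
  by (induction n) (simp_all add: G_F)

lemma t_power_inj: "t ^ i = t ^ j \<Longrightarrow> i = j"
proof (induction i j rule: linorder_wlog)
  case (le i j)
  have "t ^ j = t ^ (i + (j - i))" using le by simp
  then have "t ^ j = t ^ i * t ^ (j - i)" by (simp only: power_add)
  then have "t ^ (j - i) = 1" using le t_nonzero by simp
  then show ?case using t_not_root[of "j - i"] le by fastforce
qed metis

text \<open>Up to a power of \<open>v\<close> and the factor \<open>r\<close> this is the quantum integer \<open>[n + 1]\<close>.\<close>

definition string_coeff :: "nat \<Rightarrow> 'a" where
  "string_coeff n = r * (\<Sum>i\<le>n. inverse t ^ i)"

lemma string_coeff_nonzero: "string_coeff n \<noteq> 0"
proof
  assume "string_coeff n = 0"
  then have "(\<Sum>i\<le>n. inverse t ^ i) = 0" using r_nonzero by (simp add: string_coeff_def)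
  then have "(1 - inverse t) * (\<Sum>i<Suc n. inverse t ^ i) = 0"
    by (simp add: lessThan_Suc_atMost)
  then have "1 - inverse t ^ Suc n = 0" by (simp only: one_diff_power_eq[of "inverse t"])
  then have "t ^ Suc n = 1" by (simp add: power_inverse field_simps t_nonzero)
  then show False using t_not_root by blast
qed

lemma E_F_funpow:
  "E ((F ^^ Suc n) x) = (F ^^ Suc n) (E x) + string_coeff n *s (F ^^ n) (K x - t ^ n *s G (K' x))"
proof (induction n arbitrary: x)
  case 0
  then show ?case by (simp add: E_F string_coeff_def)
next
  case (Suc n)
  have Fn: "endo scale (F ^^ n)" by (rule endo_funpow[OF endo_F])
  note Fn_simps = module_hom.add[OF Fn] module_hom.diff[OF Fn] module_hom.scale[OF Fn]
  have KF: "K (F x) = inverse t *s F (K x)" using t_nonzero by (simp add: F_K)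
  have c: "string_coeff (Suc n) = r + string_coeff n * inverse t"
    unfolding string_coeff_def
    by (subst sum.atMost_Suc_shift) (simp add: sum_distrib_left sum_distrib_right algebra_simps)
  have c': "string_coeff (Suc n) * (t ^ n * t) = r + string_coeff n * (t ^ n * t)"
  proof -
    have "r * inverse t ^ Suc n * (t ^ n * t) = r"
      using t_nonzero by (simp add: power_inverse field_simps)
    then show ?thesis by (simp add: string_coeff_def distrib_right distrib_left mult.assoc)
  qed
  have "E ((F ^^ Suc (Suc n)) x) = E ((F ^^ Suc n) (F x))" by (simp add: funpow_swap1)
  also have "\<dots> = (F ^^ Suc n) (E (F x)) +
      string_coeff n *s (F ^^ n) (K (F x) - t ^ n *s G (K' (F x)))"
    by (rule Suc)
  also have "\<dots> = (F ^^ Suc (Suc n)) (E x) + r *s (F ^^ Suc n) (K x) - r *s (F ^^ Suc n) (G (K' x))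
     + (string_coeff n * inverse t) *s (F ^^ Suc n) (K x)
     - (string_coeff n * (t ^ n * t)) *s (F ^^ Suc n) (G (K' x))"
    by (simp add: E_F KF K'_F G_F G_simps F_simps Fn_simps scale_right_diff_distrib
       scale_right_distrib funpow_swap1 algebra_simps)
  also have "\<dots> = (F ^^ Suc (Suc n)) (E x) + string_coeff (Suc n) *s (F ^^ Suc n) (K x)
     - (string_coeff (Suc n) * (t ^ n * t)) *s (F ^^ Suc n) (G (K' x))"
    unfolding c' unfolding c by (simp add: algebra_simps)
  also have "\<dots> = (F ^^ Suc (Suc n)) (E x)
     + string_coeff (Suc n) *s (F ^^ Suc n) (K x - t ^ Suc n *s G (K' x))"
    by (simp add: F_simps Fn_simps scale_right_diff_distrib funpow_swap1 mult.commute)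
  finally show ?case .
qed

lemma string_weight_eq_0: "l \<noteq> 0 \<Longrightarrow> l - c * (g / l) = 0 \<longleftrightarrow> l\<^sup>2 = c * g" for l c g :: 'a
proof -
  assume l: "l \<noteq> 0"
  then have "(l - c * (g / l)) * l = l\<^sup>2 - c * g" by (simp add: algebra_simps power2_eq_square)
  with l show ?thesis by (metis eq_iff_diff_eq_0 mult_eq_0_iff)
qed

definition hw_vector :: "'a \<Rightarrow> 'a \<Rightarrow> 'b \<Rightarrow> bool" where
  "hw_vector l g h \<longleftrightarrow> E h = 0 \<and> K h = l *s h \<and> G h = g *s h"

lemma weight_nonzero: "K h = l *s h \<Longrightarrow> h \<noteq> 0 \<Longrightarrow> l \<noteq> 0"
  by (metis K'_K K'_simps(4) scale_zero_left)

lemma K'_eigen: "K h = l *s h \<Longrightarrow> h \<noteq> 0 \<Longrightarrow> K' h = inverse l *s h"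
  by (metis K'_K K'_simps(3) weight_nonzero scale_scale left_inverse scale_one)

lemma hw_vector_string:
  assumes "hw_vector l g h"
  shows K_hw_string: "K ((F ^^ n) h) = (l / t ^ n) *s (F ^^ n) h"
    and G_hw_string: "G ((F ^^ n) h) = g *s (F ^^ n) h"
    and E_hw_string:
      "h \<noteq> 0 \<Longrightarrow> E ((F ^^ Suc n) h) = (string_coeff n * (l - t ^ n * (g / l))) *s (F ^^ n) h"
proof -
  have Fn: "endo scale (F ^^ n)" for n by (rule endo_funpow[OF endo_F])
  note Fn_simps = module_hom.add[OF Fn] module_hom.diff[OF Fn] module_hom.scale[OF Fn]
    module_hom.zero[OF Fn]
  have h: "E h = 0" "K h = l *s h" "G h = g *s h" using assms by (auto simp: hw_vector_def)
  have tn: "t ^ n \<noteq> 0" using t_nonzero by simp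
  have "t ^ n * (l / t ^ n) = l"
    using nonzero_mult_div_cancel_left[OF tn, of l] by (simp only: times_divide_eq_right)
  moreover have "t ^ n *s K ((F ^^ n) h) = l *s (F ^^ n) h"
    by (simp only: K_F_funpow[symmetric] h(2) Fn_simps(3))
  ultimately have "t ^ n *s K ((F ^^ n) h) = t ^ n *s (l / t ^ n) *s (F ^^ n) h"
    by (simp only: scale_scale)
  then show "K ((F ^^ n) h) = (l / t ^ n) *s (F ^^ n) h"
    by (rule scale_cancel[OF tn])
  show "G ((F ^^ n) h) = g *s (F ^^ n) h" using h by (simp add: G_F_funpow Fn_simps)
  assume "h \<noteq> 0"
  have "E ((F ^^ Suc n) h) = string_coeff n *s (F ^^ n) (l *s h - t ^ n *s G (K' h))"
    unfolding E_F_funpow h(1) by (simp only: Fn_simps h(2) add_0)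
  also have "l *s h - t ^ n *s G (K' h) = (l - t ^ n * (g / l)) *s h"
    by (simp add: K'_eigen[OF h(2) \<open>h \<noteq> 0\<close>] G_simps h(3) scale_left_diff_distrib field_simps)
  finally show "E ((F ^^ Suc n) h) = (string_coeff n * (l - t ^ n * (g / l))) *s (F ^^ n) h"
    by (simp add: Fn_simps)
qed

text \<open>Apply \<open>E\<close> to the first power of \<open>F\<close> that kills \<open>h\<close>: the coefficient in \<open>E_hw_string\<close> has to
  vanish, and it vanishes only for \<open>l\<^sup>2 = t\<^sup>n g\<close>.\<close>

lemma hw_string_length:
  assumes h: "hw_vector l g h" "h \<noteq> 0"
  obtains n where "l\<^sup>2 = t ^ n * g" "(F ^^ Suc n) h = 0" "\<And>j. j \<le> n \<Longrightarrow> (F ^^ j) h \<noteq> 0"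
proof -
  obtain N where N: "(F ^^ N) h = 0" using F_nilpotent by blast
  define m where "m = (LEAST m. (F ^^ m) h = 0)"
  have m: "(F ^^ m) h = 0" unfolding m_def using N by (rule LeastI)
  have less: "(F ^^ j) h \<noteq> 0" if "j < m" for j using that not_less_Least unfolding m_def by blast
  obtain n where n: "m = Suc n" using m h(2) by (cases m) auto
  have l: "l \<noteq> 0" using weight_nonzero h by (auto simp: hw_vector_def)
  have "(string_coeff n * (l - t ^ n * (g / l))) *s (F ^^ n) h = 0"
    using E_hw_string[OF h, of n] m n by (simp add: E_simps)
  then have "string_coeff n * (l - t ^ n * (g / l)) = 0"
    using less[of n] n by (metis lessI scale_eq_0_iff)
  then have "l\<^sup>2 = t ^ n * g"
    using string_coeff_nonzero[of n] string_weight_eq_0[OF l] by (metis no_zero_divisors)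
  then show thesis using that[of n] m less n by auto
qed

lemma hw_string_up:
  assumes h: "hw_vector l g h" "h \<noteq> 0" and n: "l\<^sup>2 = t ^ n * g"
  shows "j \<le> n \<Longrightarrow> \<exists>c. c \<noteq> 0 \<and> (E ^^ j) ((F ^^ j) h) = c *s h"
    and "i < j \<Longrightarrow> (E ^^ j) ((F ^^ i) h) = 0"
proof -
  have Em: "endo scale (E ^^ m)" for m by (rule endo_funpow[OF endo_E])
  note Em_simps = module_hom.scale[OF Em] module_hom.zero[OF Em]
  have l: "l \<noteq> 0" using weight_nonzero h by (auto simp: hw_vector_def)
  then have g: "g \<noteq> 0" using n by auto
  have E_Suc: "(E ^^ Suc j) x = (E ^^ j) (E x)" for j x by (simp only: funpow_Suc_right o_apply)
  have step: "(E ^^ Suc j) ((F ^^ Suc i) h)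
      = (string_coeff i * (l - t ^ i * (g / l))) *s (E ^^ j) ((F ^^ i) h)" for i j
    unfolding E_Suc E_hw_string[OF h] Em_simps(1) by (rule refl)
  show "j \<le> n \<Longrightarrow> \<exists>c. c \<noteq> 0 \<and> (E ^^ j) ((F ^^ j) h) = c *s h"
  proof (induction j)
    case 0
    show ?case by (rule exI[of _ 1]) simp
  next
    case (Suc j)
    then obtain c where c: "c \<noteq> 0" "(E ^^ j) ((F ^^ j) h) = c *s h" by auto
    have "l - t ^ j * (g / l) \<noteq> 0"
    proof
      assume "l - t ^ j * (g / l) = 0"
      then have "t ^ n * g = t ^ j * g"
        unfolding n[symmetric] by (rule iffD1[OF string_weight_eq_0[OF l]])
      then have "t ^ n = t ^ j" using g by simp
      then show False using t_power_inj[of n j] Suc.prems by simp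
    qed
    moreover have "(E ^^ Suc j) ((F ^^ Suc j) h) = (string_coeff j * (l - t ^ j * (g / l)) * c) *s h"
      unfolding step c(2) by (rule scale_scale)
    ultimately show ?case using c(1) string_coeff_nonzero[of j]
      by (intro exI[of _ "string_coeff j * (l - t ^ j * (g / l)) * c"]) auto
  qed
  show "i < j \<Longrightarrow> (E ^^ j) ((F ^^ i) h) = 0"
  proof (induction i arbitrary: j)
    case 0
    then obtain k where "j = Suc k" by (cases j) auto
    moreover have "E h = 0" using h by (simp add: hw_vector_def)
    ultimately show ?case using Em_simps(2)[of k] by (simp only: E_Suc funpow_0)
  next
    case (Suc i)
    then obtain k where "j = Suc k" "i < k" by (cases j) auto
    then show ?case using Suc.IH[of k] by (simp only: step scale_zero_right)
  qed
qed

text \<open>The span of a string is simple for \<open>E\<close> and \<open>F\<close>: if \<open>F\<^sup>j h\<close> is the last basis vector that occurs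
  in \<open>y\<close>, then \<open>E\<^sup>j\<close> kills the earlier ones and moves this one to a non-zero multiple of \<open>h\<close>.\<close>

lemma hw_string_generates:
  assumes h: "hw_vector l g h" and y: "y \<in> span (range (\<lambda>j. (F ^^ j) h))" "y \<noteq> 0"
  shows "\<exists>j c. c \<noteq> 0 \<and> (E ^^ j) y = c *s h"
proof -
  have Fn: "endo scale (F ^^ m)" for m by (rule endo_funpow[OF endo_F])
  have En: "endo scale (E ^^ m)" for m by (rule endo_funpow[OF endo_E])
  have "h \<noteq> 0"
  proof
    assume "h = 0"
    then have "range (\<lambda>j. (F ^^ j) h) \<subseteq> {0}" using module_hom.zero[OF Fn] by auto
    then show False using y span_minimal[OF _ subspace_single_0] by blast
  qed
  obtain n where n: "l\<^sup>2 = t ^ n * g" "(F ^^ Suc n) h = 0" using hw_string_length[OF h \<open>h \<noteq> 0\<close>] .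
  have F0: "(F ^^ j) h = 0" if "j > n" for j
  proof -
    have "(F ^^ j) h = (F ^^ (j - Suc n + Suc n)) h" using that by simp
    also have "\<dots> = (F ^^ (j - Suc n)) ((F ^^ Suc n) h)" by (simp only: funpow_add o_apply)
    finally have "(F ^^ j) h = (F ^^ (j - Suc n)) ((F ^^ Suc n) h)" .
    then show ?thesis unfolding n(2) by (simp add: module_hom.zero[OF Fn])
  qed
  define S where "S m = span ((\<lambda>j. (F ^^ j) h) ` {..<m})" for m
  have "y \<in> S (Suc n)"
  proof -
    have "range (\<lambda>j. (F ^^ j) h) \<subseteq> S (Suc n)"
    proof (intro image_subsetI)
      fix j show "(F ^^ j) h \<in> S (Suc n)"
        by (cases "j > n") (auto simp: S_def F0 span_zero intro!: span_base)
    qed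
    then show ?thesis using y(1) span_minimal[OF _ subspace_span] unfolding S_def by blast
  qed
  moreover have "y \<in> S m \<Longrightarrow> m \<le> Suc n \<Longrightarrow> \<exists>j c. c \<noteq> 0 \<and> (E ^^ j) y = c *s h" for m
  proof (induction m)
    case 0
    then show ?case using y(2) by (simp add: S_def)
  next
    case (Suc m)
    then obtain k where k: "y - k *s (F ^^ m) h \<in> S m"
      unfolding S_def lessThan_Suc image_insert span_insert by blast
    show ?case
    proof (cases "k = 0")
      case True
      then show ?thesis using Suc k by simp
    next
      case False
      have "(E ^^ m) (y - k *s (F ^^ m) h) \<in> {0}"
        using k unfolding S_def
        by (rule endo_span_into[OF En subspace_single_0, rotated])
          (auto simp: hw_string_up(2)[OF h \<open>h \<noteq> 0\<close> n(1)])
      then have "(E ^^ m) y = k *s (E ^^ m) ((F ^^ m) h)"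
        by (simp add: module_hom.diff[OF En] module_hom.scale[OF En])
      moreover obtain c where "c \<noteq> 0" "(E ^^ m) ((F ^^ m) h) = c *s h"
        using hw_string_up(1)[OF h \<open>h \<noteq> 0\<close> n(1), of m] Suc.prems(2) by auto
      ultimately have "k * c \<noteq> 0" "(E ^^ m) y = (k * c) *s h" using False by auto
      then show ?thesis by blast
    qed
  qed
  ultimately show ?thesis by blast
qed

subsection \<open>Spanning by strings of highest weight vectors\<close>

definition stable :: "'b set \<Rightarrow> bool" where
  "stable Y \<longleftrightarrow> subspace Y \<and> (\<forall>x\<in>Y. E x \<in> Y \<and> F x \<in> Y \<and> K x \<in> Y \<and> K' x \<in> Y \<and> G x \<in> Y)"

lemma stable_subspace: "stable Y \<Longrightarrow> subspace Y"
  by (simp add: stable_def)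

lemma stable_mem:
  assumes "stable Y" "x \<in> Y"
  shows "E x \<in> Y" "F x \<in> Y" "K x \<in> Y" "K' x \<in> Y" "G x \<in> Y" "(F ^^ n) x \<in> Y"
proof -
  show "E x \<in> Y" "F x \<in> Y" "K x \<in> Y" "K' x \<in> Y" "G x \<in> Y"
    using assms by (auto simp: stable_def)
  show "(F ^^ n) x \<in> Y" using assms by (induction n) (auto simp: stable_def)
qed

lemma stable_0: "stable {0}"
  by (simp add: stable_def E_simps F_simps K_simps K'_simps G_simps)

lemma stable_F_funpow_descend:
  assumes Y: "stable Y" and "E x \<in> Y" "(F ^^ Suc n) x \<in> Y"
  shows "(F ^^ n) (K x - t ^ n *s G (K' x)) \<in> Y"
proof -
  note sub = stable_subspace[OF Y]
  have "string_coeff n *s (F ^^ n) (K x - t ^ n *s G (K' x))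
      = E ((F ^^ Suc n) x) - (F ^^ Suc n) (E x)"
    unfolding E_F_funpow by simp
  also have "\<dots> \<in> Y"
    using stable_mem[OF Y] assms(2,3) by (intro subspace_diff[OF sub]) auto
  finally have "inverse (string_coeff n) *s string_coeff n *s (F ^^ n) (K x - t ^ n *s G (K' x)) \<in> Y"
    by (rule subspace_scale[OF sub])
  then show ?thesis using string_coeff_nonzero by simp
qed

text \<open>The dominance condition for highest weights, for a vector that is a highest weight vector only
  modulo \<open>Y\<close>.  It is again read off from the first power of \<open>F\<close> that moves \<open>x\<close> into \<open>Y\<close>.\<close>

lemma hw_weight_mod_stable:
  assumes Y: "stable Y" and x: "E x \<in> Y" "K x - l *s x \<in> Y" "G x - g *s x \<in> Y" "x \<notin> Y"
  shows "l \<noteq> 0 \<and> (\<exists>n. l\<^sup>2 = t ^ n * g)"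
proof
  note sub = stable_subspace[OF Y]
  show l: "l \<noteq> 0"
  proof
    assume "l = 0"
    then have "K' (K x) \<in> Y" using x(2) stable_mem(4)[OF Y] by simp
    with x(4) show False by (simp add: K'_K)
  qed
  obtain N where N: "(F ^^ N) x = 0" using F_nilpotent by blast
  define m where "m = (LEAST m. (F ^^ m) x \<in> Y)"
  have "(F ^^ N) x \<in> Y" using N subspace_0[OF sub] by simp
  then have m: "(F ^^ m) x \<in> Y" unfolding m_def by (rule LeastI)
  have less: "(F ^^ j) x \<notin> Y" if "j < m" for j using that not_less_Least unfolding m_def by blast
  obtain n where n: "m = Suc n" using m x(4) by (cases m) auto
  have Fn: "endo scale (F ^^ n)" by (rule endo_funpow[OF endo_F])
  define a where "a = K x - l *s x"
  define b where "b = G x - g *s x"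
  have K'x: "K' x = inverse l *s (x - K' a)"
    using l by (simp add: a_def K'_simps K'_K)
  have "K x - t ^ n *s G (K' x) = (l - t ^ n * (g / l)) *s x + (a - (t ^ n * inverse l) *s (b - K' (G a)))"
    unfolding K'x by (simp add: G_simps a_def[THEN eq_diff_eq[THEN iffD1], symmetric]
        b_def[THEN eq_diff_eq[THEN iffD1], symmetric] G_K' algebra_simps scale_right_diff_distrib
        scale_right_distrib scale_left_diff_distrib divide_inverse)
  moreover have ab: "a - (t ^ n * inverse l) *s (b - K' (G a)) \<in> Y"
    using x(2,3) stable_mem[OF Y] unfolding a_def[symmetric] b_def[symmetric]
    by (intro subspace_diff[OF sub] subspace_scale[OF sub]) auto
  moreover have "(F ^^ n) (K x - t ^ n *s G (K' x)) \<in> Y"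
    using stable_F_funpow_descend[OF Y x(1)] m n by simp
  ultimately have "(F ^^ n) ((l - t ^ n * (g / l)) *s x + (a - (t ^ n * inverse l) *s (b - K' (G a)))) \<in> Y"
    by simp
  then have "(l - t ^ n * (g / l)) *s (F ^^ n) x \<in> Y"
    unfolding module_hom.add[OF Fn] module_hom.scale[OF Fn]
    using stable_mem(6)[OF Y ab, of n] subspace_diff[OF sub] by (metis add_diff_cancel_right')
  then have "l - t ^ n * (g / l) = 0"
    using less[of n] n subspace_scale[OF sub, of _ "inverse (l - t ^ n * (g / l))"]
    by (metis lessI scale_scale left_inverse scale_one)
  then show "\<exists>n. l\<^sup>2 = t ^ n * g" using string_weight_eq_0[OF l] by blast
qed

definition strings :: "'b set" where
  "strings = {x. \<exists>n l g h. hw_vector l g h \<and> x = (F ^^ n) h}"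

lemma strings_cases:
  assumes "x \<in> strings"
  obtains (zero) "x = 0" | (string) n l g h where "hw_vector l g h" "h \<noteq> 0" "x = (F ^^ n) h"
  using assms module_hom.zero[OF endo_funpow[OF endo_F]] unfolding strings_def by fastforce

lemma strings_eigen: "x \<in> strings \<Longrightarrow> \<exists>l. K x = l *s x" "x \<in> strings \<Longrightarrow> \<exists>g. G x = g *s x"
  unfolding strings_def using K_hw_string G_hw_string by blast+

lemma stable_span_strings: "stable (span strings)"
proof -
  have gen: "E x \<in> span strings \<and> F x \<in> span strings \<and> K x \<in> span strings \<and> K' x \<in> span strings
      \<and> G x \<in> span strings" if x: "x \<in> strings" for x
  proof -
    have K: "K x \<in> span strings" and G: "G x \<in> span strings"
      using strings_eigen[OF x] span_scale[OF span_base[OF x]] by auto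
    have K': "K' x \<in> span strings"
    proof (cases "x = 0")
      case True
      then show ?thesis by (simp add: K'_simps span_zero)
    next
      case False
      obtain l where "K x = l *s x" using strings_eigen[OF x] by blast
      then have "K' x = inverse l *s x" by (rule K'_eigen[OF _ False])
      then show ?thesis using span_scale[OF span_base[OF x]] by simp
    qed
    have F: "F x \<in> span strings"
    proof -
      obtain n l g h where "hw_vector l g h" "x = (F ^^ n) h" using x unfolding strings_def by blast
      then have "hw_vector l g h \<and> F x = (F ^^ Suc n) h" by simp
      then have "F x \<in> strings" unfolding strings_def by blast
      then show ?thesis by (rule span_base)
    qed
    have E: "E x \<in> span strings"
      using x
    proof (cases rule: strings_cases)
      case zero
      then show ?thesis by (simp add: E_simps span_zero)
    next
      case (string n l g h)
      show ?thesis
      proof (cases n)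
        case 0
        then show ?thesis using string by (simp add: hw_vector_def span_zero)
      next
        case (Suc m)
        have "(F ^^ m) h \<in> strings" using string unfolding strings_def by blast
        then show ?thesis unfolding string(3) Suc E_hw_string[OF string(1,2)]
          by (intro span_scale span_base)
      qed
    qed
    show ?thesis using E F G K K' by blast
  qed
  show ?thesis unfolding stable_def
    using gen subspace_span endo_E endo_F endo_K endo_K' endo_G
    by (auto intro: endo_span_into[OF _ subspace_span])
qed

text \<open>Let \<open>V'\<close> be the span of the strings.  As \<open>E\<close> is nilpotent, it suffices that \<open>E x \<in> V'\<close>
  implies \<open>x \<in> V'\<close>, and by the assumption \<open>x\<close> may be taken to be an eigenvector of \<open>K\<close> and \<open>G\<close> modulo
  \<open>V'\<close>, for the eigenvalues \<open>l\<close> and \<open>g\<close>.  If \<open>x \<notin> V'\<close>, then \<open>l\<^sup>2 = t\<^sup>n g\<close>, which puts the weight \<open>t l\<close>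
  of \<open>E x\<close> in the upper half of any string that meets it.  There a string vector is never the last
  of its string, hence is \<open>E\<close> of the next one.  So \<open>E x = E y\<close> with \<open>y \<in> V'\<close>, and \<open>x - y\<close> is in the
  kernel of \<open>E\<close>, which is spanned by highest weight vectors.  This plays the part that the Casimir
  element has in the classical proof of complete reducibility, without splitting any generalized
  eigenspaces beforehand.\<close>

lemma span_strings:
  assumes diag: "\<And>Y x. stable Y \<Longrightarrow> E x \<in> Y \<Longrightarrow>
    x \<in> span {x. E x \<in> Y \<and> (\<exists>l g. K x - l *s x \<in> Y \<and> G x - g *s x \<in> Y)}"
  shows "span strings = UNIV"
proof -
  let ?V = "span strings"
  note st = stable_span_strings
  have ker: "x \<in> ?V" if "E x = 0" for x
  proof -
    have "x \<in> span {x. E x \<in> {0} \<and> (\<exists>l g. K x - l *s x \<in> {0} \<and> G x - g *s x \<in> {0})}"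
      using diag[OF stable_0] that by simp
    moreover have "{x. E x \<in> {0} \<and> (\<exists>l g. K x - l *s x \<in> {0} \<and> G x - g *s x \<in> {0})} \<subseteq> strings"
    proof
      fix x assume "x \<in> {x. E x \<in> {0} \<and> (\<exists>l g. K x - l *s x \<in> {0} \<and> G x - g *s x \<in> {0})}"
      then obtain l g where "hw_vector l g x" by (auto simp: hw_vector_def)
      moreover have "x = (F ^^ 0) x" by simp
      ultimately show "x \<in> strings" unfolding strings_def by blast
    qed
    ultimately show ?thesis using span_mono by blast
  qed
  \<comment> \<open>All components of \<open>E x\<close> other than the one of weight \<open>(t l, g)\<close> are in \<open>E V'\<close> for formal reasons,
    which is why the components are compared modulo this image.\<close>
  define Z where "Z = E ` ?V"
  have Z: "subspace Z" unfolding Z_def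
    by (intro module_hom.subspace_image[OF endo_E] subspace_span)
  have KZ: "K z \<in> Z" and GZ: "G z \<in> Z" if z: "z \<in> Z" for z
  proof -
    obtain y where y: "y \<in> ?V" "z = E y" using z by (auto simp: Z_def)
    have "K z = E (t *s K y)" "G z = E (G y)" by (simp_all add: y K_E G_E E_simps)
    then show "K z \<in> Z" "G z \<in> Z"
      unfolding Z_def using stable_mem[OF st y(1)] span_scale by blast+
  qed
  have eig: "x \<in> ?V" if x: "E x \<in> ?V" "K x - l *s x \<in> ?V" "G x - g *s x \<in> ?V" for x l g
  proof (rule ccontr)
    assume "x \<notin> ?V"
    then obtain n where l: "l \<noteq> 0" and n: "l\<^sup>2 = t ^ n * g"
      using hw_weight_mod_stable[OF st x] by blast
    then have g: "g \<noteq> 0" by auto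
    have "K (E x) - (t * l) *s E x = E (t *s (K x - l *s x))"
      by (simp add: K_E E_simps scale_right_diff_distrib)
    then have "K (E x) - (t * l) *s E x \<in> Z" using x(2) span_scale unfolding Z_def by auto
    from eigencomponent_mod[OF endo_K Z KZ strings_eigen(1) x(1) this]
    obtain w1 where w1: "w1 \<in> span {s \<in> strings. K s = (t * l) *s s}" "E x - w1 \<in> Z" by blast
    have "G w1 - g *s w1 = E (G x - g *s x) - (G (E x - w1) - g *s (E x - w1))"
      by (simp add: G_simps E_simps G_E scale_right_diff_distrib)
    also have "\<dots> \<in> Z"
    proof (rule subspace_diff[OF Z])
      show "E (G x - g *s x) \<in> Z" using x(3) by (simp add: Z_def)
      show "G (E x - w1) - g *s (E x - w1) \<in> Z"
        using GZ[OF w1(2)] w1(2) by (rule subspace_diff[OF Z _ subspace_scale[OF Z]])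
    qed
    finally have "G w1 - g *s w1 \<in> Z" .
    from eigencomponent_mod[OF endo_G Z GZ _ w1(1) this] strings_eigen(2)
    obtain w2 where w2: "w2 \<in> span {s \<in> {s \<in> strings. K s = (t * l) *s s}. G s = g *s s}"
        "w1 - w2 \<in> Z" by blast
    have "s \<in> Z" if s: "s \<in> strings" "K s = (t * l) *s s" "G s = g *s s" for s
      using s(1)
    proof (cases rule: strings_cases)
      case zero
      then show ?thesis using subspace_0[OF Z] by simp
    next
      case (string i l' g' h)
      show ?thesis
      proof (cases "s = 0")
        case True
        then show ?thesis using subspace_0[OF Z] by simp
      next
        case False
        have "(l' / t ^ i) *s s = (t * l) *s s"
          using K_hw_string[OF string(1), of i] s(2) string(3) by simp
        then have "l' / t ^ i = t * l" using False by (metis scale_cancel_right)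
        then have l': "l' = t ^ Suc i * l" using t_nonzero by (simp add: field_simps)
        have "g' *s s = g *s s" using G_hw_string[OF string(1), of i] s(3) string(3) by simp
        then have g': "g' = g" using False by (metis scale_cancel_right)
        let ?c = "string_coeff i * (l' - t ^ i * (g' / l'))"
        have "l' \<noteq> 0" using l' l t_nonzero by simp
        have "?c \<noteq> 0"
        proof
          assume "?c = 0"
          then have "l' - t ^ i * (g' / l') = 0" using string_coeff_nonzero[of i] by (metis mult_eq_0_iff)
          then have "l'\<^sup>2 = t ^ i * g" using string_weight_eq_0[OF \<open>l' \<noteq> 0\<close>] g' by blast
          then have "t ^ (2 * Suc i + n) * g = t ^ i * g"
            unfolding l' power_mult_distrib n by (simp add: power_add power_mult power2_eq_square ac_simps)
          then have "t ^ (2 * Suc i + n) = t ^ i" using g by (metis mult_cancel_right)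
          then have "2 * Suc i + n = i" by (rule t_power_inj)
          then show False by simp
        qed
        have "(F ^^ Suc i) h \<in> strings" using string(1) unfolding strings_def by blast
        then have "inverse ?c *s (F ^^ Suc i) h \<in> ?V" by (intro span_scale span_base)
        moreover have "E (inverse ?c *s (F ^^ Suc i) h) = s"
          unfolding E_simps E_hw_string[OF string(1,2)] scale_scale string(3)
          using \<open>?c \<noteq> 0\<close> by (metis left_inverse scale_one)
        ultimately show ?thesis unfolding Z_def by (metis imageI)
      qed
    qed
    then have "{s \<in> {s \<in> strings. K s = (t * l) *s s}. G s = g *s s} \<subseteq> Z" by auto
    then have "w2 \<in> Z" using w2(1) span_minimal[OF _ Z] by blast
    then have "w2 + (w1 - w2) + (E x - w1) \<in> Z" using w1(2) w2(2) by (intro subspace_add[OF Z])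
    then have "E x \<in> Z" by simp
    then obtain y where y: "y \<in> ?V" "E x = E y" by (auto simp: Z_def)
    then have "x - y \<in> ?V" using ker by (simp add: E_simps)
    then have "x - y + y \<in> ?V" using y(1) by (rule span_add)
    with \<open>x \<notin> ?V\<close> show False by simp
  qed
  have up: "x \<in> ?V" if "E x \<in> ?V" for x
  proof -
    have "{x. E x \<in> ?V \<and> (\<exists>l g. K x - l *s x \<in> ?V \<and> G x - g *s x \<in> ?V)} \<subseteq> ?V"
      using eig by blast
    then show ?thesis using diag[OF st that] span_minimal[OF _ subspace_span] by blast
  qed
  obtain N where N: "(E ^^ N) x = 0" for x using E_nilpotent by blast
  have down: "(E ^^ n) x \<in> ?V \<Longrightarrow> x \<in> ?V" for n x
    by (induction n) (use up in auto)
  have "x \<in> ?V" for x by (rule down[of N]) (simp add: N span_zero)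
  then show ?thesis by blast
qed

text \<open>For \<open>G = 1\<close> the factor \<open>K - t\<^sup>n K\<^sup>-\<^sup>1\<close> met when descending along a string is, up to the invertible
  \<open>K\<close>, the product of \<open>K - q\<^sup>n\<close> and \<open>K + q\<^sup>n\<close>.  All these eigenvalues are distinct, so that \<open>K\<close> is
  diagonalizable on \<open>{x. E x \<in> Y}\<close> modulo \<open>Y\<close>.\<close>

lemma span_strings_if_G_id:
  assumes G: "\<And>x. G x = x" and q: "q\<^sup>2 = t" and two: "(2 :: 'a) \<noteq> 0"
  shows "span strings = UNIV"
proof (rule span_strings)
  fix Y x assume Y: "stable Y" and x: "E x \<in> Y"
  note sub = stable_subspace[OF Y]
  let ?X = "{x. E x \<in> Y}"
  define M where "M n = {m. \<exists>i<n. m = q ^ i \<or> m = - (q ^ i)}" for n :: nat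
  have X: "subspace ?X" by (rule subspace_vimage_endo[OF endo_E sub])
  have mod_step: "y \<in> span {x\<in>?X. x \<in> Y \<or> (\<exists>l\<in>insert m M. K x - l *s x \<in> Y)}"
    if "m \<notin> M" "y \<in> ?X" "K y - m *s y \<in> span {x\<in>?X. x \<in> Y \<or> (\<exists>l\<in>M. K x - l *s x \<in> Y)}" for m M y
    using stable_mem(3)[OF Y] X that by (rule span_eigenvectors_mod_step[OF endo_K sub])
  have sq: "q ^ i * q ^ i = t ^ i" for i
    by (simp add: q[symmetric] power2_eq_square power_mult_distrib)
  have qi: "q ^ n \<noteq> q ^ i \<and> q ^ n \<noteq> - (q ^ i) \<and> - (q ^ n) \<noteq> q ^ i" if "i < n" for i n
  proof -
    have "t ^ n \<noteq> t ^ i" using t_power_inj that by blast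
    then show ?thesis using sq[of n] sq[of i] by (metis minus_mult_minus)
  qed
  have qn: "- (q ^ n) \<noteq> q ^ n" for n
  proof
    assume *: "- (q ^ n) = q ^ n"
    have "2 * q ^ n = q ^ n + - (q ^ n)" by (simp only: * mult_2)
    then have "2 * q ^ n = 0" by (simp only: add.right_inverse)
    then have "q ^ n = 0" using two by (simp only: mult_eq_0_iff simp_thms)
    then have "t ^ n = 0" by (simp only: sq[symmetric] mult_zero_left)
    then show False using t_nonzero by simp
  qed
  have "y \<in> span {x\<in>?X. x \<in> Y \<or> (\<exists>m\<in>M n. K x - m *s x \<in> Y)}" if "E y \<in> Y" "(F ^^ n) y \<in> Y" for y n
    using that
  proof (induction n arbitrary: y)
    case 0
    then have "y \<in> {x\<in>?X. x \<in> Y \<or> (\<exists>m\<in>M 0. K x - m *s x \<in> Y)}" by simp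
    then show ?case by (rule span_base)
  next
    case (Suc n)
    have KX: "K z \<in> ?X" if "z \<in> ?X" for z
    proof -
      have "E (K z) = inverse t *s K (E z)" using t_nonzero by (simp add: K_E)
      then show ?thesis using that stable_mem(3)[OF Y] subspace_scale[OF sub] by simp
    qed
    \<comment> \<open>\<open>y1 = (K - q\<^sup>n) (K + q\<^sup>n) y\<close>, whose two factors are split off one after the other.\<close>
    define y1 where "y1 = K (K y) - t ^ n *s y"
    have "y1 = K (K y - t ^ n *s G (K' y))" by (simp add: y1_def K_simps G K_K')
    then have "(F ^^ n) y1 = t ^ n *s K ((F ^^ n) (K y - t ^ n *s G (K' y)))"
      by (simp only: K_F_funpow)
    then have "(F ^^ n) y1 \<in> Y"
      using stable_F_funpow_descend[OF Y Suc.prems] stable_mem(3)[OF Y] subspace_scale[OF sub] by simp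
    moreover have "y1 \<in> ?X" unfolding y1_def
      using Suc.prems(1) KX by (intro subspace_diff[OF X] subspace_scale[OF X]) auto
    ultimately have y1: "y1 \<in> span {x\<in>?X. x \<in> Y \<or> (\<exists>m\<in>M n. K x - m *s x \<in> Y)}" using Suc.IH by simp
    define u where "u = K y - (- (q ^ n)) *s y"
    have "u \<in> ?X" unfolding u_def
      using Suc.prems(1) KX by (intro subspace_diff[OF X] subspace_scale[OF X]) auto
    moreover have "K u - q ^ n *s u = y1"
      by (simp add: u_def y1_def K_simps sq scale_right_diff_distrib scale_right_distrib
         module_hom.neg[OF endo_K])
    moreover have "q ^ n \<notin> M n" using qi by (auto simp: M_def)
    ultimately have u: "u \<in> span {x\<in>?X. x \<in> Y \<or> (\<exists>m\<in>insert (q ^ n) (M n). K x - m *s x \<in> Y)}"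
      using y1 mod_step[of "q ^ n" "M n" u] by simp
    have "- (q ^ n) \<notin> insert (q ^ n) (M n)" using qi qn by (auto simp: M_def)
    moreover have "y \<in> ?X" using Suc.prems(1) by simp
    ultimately have "y \<in> span {x\<in>?X. x \<in> Y \<or> (\<exists>m\<in>insert (- (q ^ n)) (insert (q ^ n) (M n)). K x - m *s x \<in> Y)}"
      using u unfolding u_def by (rule mod_step)
    moreover have "insert (- (q ^ n)) (insert (q ^ n) (M n)) = M (Suc n)"
      by (auto simp: M_def less_Suc_eq)
    ultimately show ?case by simp
  qed
  moreover obtain N where "(F ^^ N) x = 0" using F_nilpotent by blast
  ultimately have "x \<in> span {x\<in>?X. x \<in> Y \<or> (\<exists>m\<in>M N. K x - m *s x \<in> Y)}" using x subspace_0[OF sub] by simp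
  moreover have "{x\<in>?X. x \<in> Y \<or> (\<exists>m\<in>M N. K x - m *s x \<in> Y)}
      \<subseteq> {x. E x \<in> Y \<and> (\<exists>l g. K x - l *s x \<in> Y \<and> G x - g *s x \<in> Y)}"
  proof
    fix x assume "x \<in> {x\<in>?X. x \<in> Y \<or> (\<exists>m\<in>M N. K x - m *s x \<in> Y)}"
    then have "E x \<in> Y" "\<exists>m. K x - m *s x \<in> Y"
      using subspace_diff[OF sub stable_mem(3)[OF Y] subspace_scale[OF sub]] by blast+
    moreover have "G x - 1 *s x \<in> Y" using subspace_0[OF sub] by (simp add: G)
    ultimately show "x \<in> {x. E x \<in> Y \<and> (\<exists>l g. K x - l *s x \<in> Y \<and> G x - g *s x \<in> Y)}" by blast
  qed
  ultimately show "x \<in> span {x. E x \<in> Y \<and> (\<exists>l g. K x - l *s x \<in> Y \<and> G x - g *s x \<in> Y)}"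
    using span_mono by blast
qed

text \<open>On vectors with \<open>K y = l y\<close> the factor met when descending along a string is, up to a scalar,
  \<open>G - l\<^sup>2 / t\<^sup>n\<close>.  These eigenvalues are distinct, so diagonalizability of \<open>K\<close> forces that of \<open>G\<close>.\<close>

lemma span_strings_if_K_diagonalizable:
  assumes K: "span {x. \<exists>l. K x = l *s x} = UNIV"
  shows "span strings = UNIV"
proof (rule span_strings)
  fix Y x assume Y: "stable Y" and x: "E x \<in> Y"
  note sub = stable_subspace[OF Y]
  let ?T = "{x. E x \<in> Y \<and> (\<exists>l g. K x - l *s x \<in> Y \<and> G x - g *s x \<in> Y)}"
  have EY: "subspace {x. E x \<in> Y}" by (rule subspace_vimage_endo[OF endo_E sub])
  have "K z \<in> {x. E x \<in> Y}" if "z \<in> {x. E x \<in> Y}" for z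
  proof -
    have "E (K z) = inverse t *s K (E z)" using t_nonzero by (simp add: K_E)
    then show ?thesis using that stable_mem(3)[OF Y] subspace_scale[OF sub] by simp
  qed
  then have "x \<in> span {x \<in> {x. E x \<in> Y}. \<exists>l. K x = l *s x}"
    using x K by (intro span_eigenvectors_subspace[OF endo_K EY]) auto
  moreover have "y \<in> span ?T" if y: "E y \<in> Y" "K y = l *s y" "y \<noteq> 0" for y l
  proof -
    have l: "l \<noteq> 0" using weight_nonzero y by blast
    let ?X = "{x. E x \<in> Y \<and> K x = l *s x}"
    define M where "M n = {m. \<exists>i<n. m = l\<^sup>2 / t ^ i}" for n :: nat
    have X: "subspace ?X"
      using EY by (auto simp: subspace_def K_simps scale_right_distrib mult.commute)
    have mod_step: "y \<in> span {x\<in>?X. x \<in> Y \<or> (\<exists>l\<in>insert m M. G x - l *s x \<in> Y)}"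
      if "m \<notin> M" "y \<in> ?X" "G y - m *s y \<in> span {x\<in>?X. x \<in> Y \<or> (\<exists>l\<in>M. G x - l *s x \<in> Y)}" for m M y
      using stable_mem(5)[OF Y] X that by (rule span_eigenvectors_mod_step[OF endo_G sub])
    have *: "y \<in> span {x\<in>?X. x \<in> Y \<or> (\<exists>m\<in>M n. G x - m *s x \<in> Y)}" if "y \<in> ?X" "(F ^^ n) y \<in> Y" for y n
      using that
    proof (induction n arbitrary: y)
      case 0
      then have "y \<in> {x\<in>?X. x \<in> Y \<or> (\<exists>m\<in>M 0. G x - m *s x \<in> Y)}" by simp
      then show ?case by (rule span_base)
    next
      case (Suc n)
      have tn: "t ^ n \<noteq> 0" using t_nonzero by simp
      have Fn: "endo scale (F ^^ n)" by (rule endo_funpow[OF endo_F])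
      define y1 where "y1 = G y - (l\<^sup>2 / t ^ n) *s y"
      have "K' y = inverse l *s y"
      proof (cases "y = 0")
        case True
        then show ?thesis by (simp add: K'_simps)
      next
        case False
        then show ?thesis using K'_eigen Suc.prems(1) by blast
      qed
      then have "(- (l / t ^ n)) *s (K y - t ^ n *s G (K' y)) = y1"
        using Suc.prems(1) t_nonzero l
        by (simp add: y1_def G_simps scale_right_diff_distrib power2_eq_square)
      then have "(F ^^ n) y1 = (- (l / t ^ n)) *s (F ^^ n) (K y - t ^ n *s G (K' y))"
        by (metis module_hom.scale[OF Fn])
      then have "(F ^^ n) y1 \<in> Y"
        using stable_F_funpow_descend[OF Y _ Suc.prems(2)] Suc.prems(1) subspace_scale[OF sub]
        by (metis (mono_tags, lifting) mem_Collect_eq)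
      moreover have "G y \<in> ?X"
        using Suc.prems(1) stable_mem(5)[OF Y] by (simp add: G_E[symmetric] G_K[symmetric] G_simps)
      then have "y1 \<in> ?X" unfolding y1_def
        using Suc.prems(1) by (intro subspace_diff[OF X] subspace_scale[OF X])
      ultimately have y1: "y1 \<in> span {x\<in>?X. x \<in> Y \<or> (\<exists>m\<in>M n. G x - m *s x \<in> Y)}" by (intro Suc.IH)
      have "l\<^sup>2 / t ^ n \<notin> M n"
      proof
        assume "l\<^sup>2 / t ^ n \<in> M n"
        then obtain i where "i < n" "l\<^sup>2 / t ^ n = l\<^sup>2 / t ^ i" by (auto simp: M_def)
        then have "t ^ n = t ^ i" using l t_nonzero by (simp add: field_simps)
        then show False using t_power_inj \<open>i < n\<close> by blast
      qed
      then have "y \<in> span {x\<in>?X. x \<in> Y \<or> (\<exists>m\<in>insert (l\<^sup>2 / t ^ n) (M n). G x - m *s x \<in> Y)}"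
        using Suc.prems(1) y1 unfolding y1_def by (rule mod_step)
      moreover have "insert (l\<^sup>2 / t ^ n) (M n) = M (Suc n)"
        by (auto simp: M_def less_Suc_eq)
      ultimately show ?case by simp
    qed
    obtain N where "(F ^^ N) y = 0" using F_nilpotent by blast
    then have "y \<in> span {x\<in>?X. x \<in> Y \<or> (\<exists>m\<in>M N. G x - m *s x \<in> Y)}"
      using *[of y N] y subspace_0[OF sub] by simp
    moreover have "{x\<in>?X. x \<in> Y \<or> (\<exists>m\<in>M N. G x - m *s x \<in> Y)} \<subseteq> ?T"
    proof
      fix x assume x: "x \<in> {x\<in>?X. x \<in> Y \<or> (\<exists>m\<in>M N. G x - m *s x \<in> Y)}"
      then have "K x - l *s x \<in> Y" "\<exists>m. G x - m *s x \<in> Y"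
        using subspace_0[OF sub] subspace_diff[OF sub stable_mem(5)[OF Y] subspace_scale[OF sub]]
        by auto
      with x show "x \<in> ?T" by blast
    qed
    ultimately show ?thesis using span_mono by blast
  qed
  then have "{x \<in> {x. E x \<in> Y}. \<exists>l. K x = l *s x} \<subseteq> span ?T"
    using span_zero by blast
  ultimately show "x \<in> span ?T" using span_minimal[OF _ subspace_span] by blast
qed
end

section \<open>Block decomposition of the mirabolic relations\<close>

text \<open>The operators by which the generators act on a finite-dimensional module.  Characteristic 2 is
  excluded because \<open>v\<^sup>n\<close> and \<open>- v\<^sup>n\<close> have to be different eigenvalues of \<open>k\<close>.\<close>

locale mirabolic_rep = finite_dimensional_vector_space scale Basis
  for scale :: "'a::field \<Rightarrow> 'b::ab_group_add \<Rightarrow> 'b" (infixr "*s" 75) and Basis :: "'b set" +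
  fixes e f k k' l :: "'b \<Rightarrow> 'b" and v :: 'a
  assumes endo_e: "endo scale e" and endo_f: "endo scale f" and endo_k: "endo scale k"
    and endo_k': "endo scale k'" and endo_l: "endo scale l"
    and k_k': "k (k' x) = x" and k'_k: "k' (k x) = x"
    and k_e: "k (e x) = v\<^sup>2 *s e (k x)" and k_f: "k (f x) = inverse (v\<^sup>2) *s f (k x)"
    and e_f: "e (f x) - f (e x) = inverse (v - inverse v) *s (k x - k' x)"
    and l_l: "l (l x) = l x" and k_l: "k (l x) = l (k x)"
    and l_e_l: "l (e (l x)) = l (e x)" and l_f_l: "l (f (l x)) = f (l x)"
    and e_l_e: "(v + inverse v) *s e (l (e x)) = inverse v *s e (e (l x)) + v *s l (e (e x))"
    and f_l_f: "(v + inverse v) *s f (l (f x)) = inverse v *s l (f (f x)) + v *s f (f (l x))"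
    and v_nonzero: "v \<noteq> 0" and v_not_root: "n > 0 \<Longrightarrow> v ^ n \<noteq> 1" and two_nonzero: "(2 :: 'a) \<noteq> 0"
begin

abbreviation t :: 'a where "t \<equiv> v\<^sup>2"
abbreviation u :: 'a where "u \<equiv> v - inverse v"

lemma t_not_root: "n > 0 \<Longrightarrow> t ^ n \<noteq> 1"
  using v_not_root[of "2 * n"] by (simp add: power_mult)

lemma u_nonzero: "u \<noteq> 0"
proof
  assume "u = 0"
  then have "v * inverse v = v * v" by simp
  then show False using v_not_root[of 2] v_nonzero by (simp add: power2_eq_square)
qed

lemmas endo_simps =
  module_hom.add[OF endo_e] module_hom.diff[OF endo_e] module_hom.scale[OF endo_e] module_hom.zero[OF endo_e]
  module_hom.add[OF endo_f] module_hom.diff[OF endo_f] module_hom.scale[OF endo_f] module_hom.zero[OF endo_f]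
  module_hom.add[OF endo_k] module_hom.diff[OF endo_k] module_hom.scale[OF endo_k] module_hom.zero[OF endo_k]
  module_hom.add[OF endo_k'] module_hom.diff[OF endo_k'] module_hom.scale[OF endo_k'] module_hom.zero[OF endo_k']
  module_hom.add[OF endo_l] module_hom.diff[OF endo_l] module_hom.scale[OF endo_l] module_hom.zero[OF endo_l]
  scale_right_distrib scale_right_diff_distrib

lemma endoI:
  assumes "\<And>x y. T (x + y) = T x + T y" "\<And>c x. T (c *s x) = c *s T x"
  shows "endo scale T"
  using assms by unfold_locales

text \<open>The relations \<open>\<ell>e\<ell> = \<ell>e\<close> and \<open>\<ell>f\<ell> = f\<ell>\<close> say that \<open>e\<close> preserves the kernel and \<open>f\<close> the image of the
  idempotent \<open>\<ell>\<close>.  In the decomposition into image and kernel, \<open>a\<close> is the off-diagonal block of \<open>e\<close>, from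
  the image to the kernel, and \<open>b\<close> is that of \<open>f\<close>, in the other direction; \<open>E\<close> and \<open>F\<close> are the block
  diagonal parts.  The operator \<open>G\<close> is chosen so that \<open>E F - F E = (k - G k\<^sup>-\<^sup>1) / (v - v\<^sup>-\<^sup>1)\<close>.\<close>

definition a :: "'b \<Rightarrow> 'b" where "a x = e (l x) - l (e x)"
definition b :: "'b \<Rightarrow> 'b" where "b x = l (f x) - f (l x)"
definition E :: "'b \<Rightarrow> 'b" where "E x = e x - a x"
definition F :: "'b \<Rightarrow> 'b" where "F x = f x - b x"
definition G :: "'b \<Rightarrow> 'b" where "G x = x + u *s (a (b (k x)) - b (a (k x)))"

lemma endo_a: "endo scale a" and endo_b: "endo scale b"
  by (rule endoI; simp add: a_def b_def endo_simps)+

lemma endo_E: "endo scale E" and endo_F: "endo scale F"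
  by (rule endoI; simp add: E_def F_def endo_simps
    module_hom.add[OF endo_a] module_hom.scale[OF endo_a]
    module_hom.add[OF endo_b] module_hom.scale[OF endo_b])+

lemmas endo_ab_simps =
  module_hom.add[OF endo_a] module_hom.diff[OF endo_a] module_hom.scale[OF endo_a] module_hom.zero[OF endo_a]
  module_hom.add[OF endo_b] module_hom.diff[OF endo_b] module_hom.scale[OF endo_b] module_hom.zero[OF endo_b]
  module_hom.add[OF endo_E] module_hom.diff[OF endo_E] module_hom.scale[OF endo_E] module_hom.zero[OF endo_E]
  module_hom.add[OF endo_F] module_hom.diff[OF endo_F] module_hom.scale[OF endo_F] module_hom.zero[OF endo_F]

lemma endo_G: "endo scale G"
  by (rule endoI) (simp_all add: G_def endo_simps endo_ab_simps mult.commute algebra_simps)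

lemma e_eq: "e x = E x + a x" and f_eq: "f x = F x + b x"
  by (simp_all add: E_def F_def)

lemma block_simps:
  "l (a x) = 0" "a (l x) = a x" "l (b x) = b x" "b (l x) = 0"
  "l (E x) = E (l x)" "l (F x) = F (l x)"
  by (simp_all add: a_def b_def E_def F_def endo_simps l_l l_e_l l_f_l)

lemma a_a: "a (a x) = 0" and b_b: "b (b x) = 0"
  by (metis block_simps(1,2) endo_ab_simps(4)) (metis block_simps(3,4) endo_ab_simps(8))

lemma a_b_block_simps:
  "a (E (l x)) = a (E x)" "a (F (l x)) = a (F x)" "b (E (l x)) = 0" "b (F (l x)) = 0"
  using block_simps by metis+

text \<open>This is the block from the image to the kernel of \<open>\<ell>\<close> in the cubic relation; the other blocks of
  that relation are trivial.\<close>

lemma E_a: "E (a x) = t *s a (E x)"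
proof -
  have "(v + inverse v) *s (E (E (l x)) + a (E x))
      = inverse v *s (E (E (l x)) + E (a x) + a (E x)) + v *s E (E (l x))"
    using e_l_e[of x]
    by (simp add: e_eq endo_simps endo_ab_simps block_simps a_b_block_simps a_a add.assoc)
  then have "inverse v *s E (a x) = v *s a (E x)"
    by (simp add: endo_simps scale_left_distrib algebra_simps)
  then have "v *s inverse v *s E (a x) = v *s v *s a (E x)" by simp
  then show ?thesis using v_nonzero by (simp add: power2_eq_square)
qed

lemma F_b: "F (b x) = inverse t *s b (F x)"
proof -
  have "(v + inverse v) *s (F (F (l x)) + F (b x))
      = inverse v *s (F (F (l x)) + F (b x) + b (F x)) + v *s F (F (l x))"
    using f_l_f[of x]
    by (simp add: f_eq endo_simps endo_ab_simps block_simps a_b_block_simps b_b add.assoc)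
  then have "inverse v *s b (F x) = v *s F (b x)"
    by (simp add: endo_simps scale_left_distrib algebra_simps)
  then have "inverse v *s inverse v *s b (F x) = inverse v *s v *s F (b x)" by simp
  then show ?thesis using v_nonzero by (simp add: power2_eq_square)
qed

lemma k'_l: "k' (l x) = l (k' x)"
  by (metis k_l k_k' k'_k)

lemma E_F_expand:
  "E (F x) - F (E x) + (E (b x) - b (E x)) + (a (F x) - F (a x)) + (a (b x) - b (a x))
    = inverse u *s (k x - k' x)"
  using e_f[of x] by (simp add: e_eq f_eq endo_ab_simps algebra_simps)

text \<open>Compare the off-diagonal blocks in \<open>e f - f e = (k - k\<^sup>-\<^sup>1) / (v - v\<^sup>-\<^sup>1)\<close>, whose right side commutes
  with \<open>\<ell>\<close>: \<open>E b - b E\<close> maps the kernel to the image and \<open>a F - F a\<close> the image to the kernel.\<close>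

lemma E_b: "E (b x) = b (E x)" and F_a: "F (a x) = a (F x)"
proof -
  let ?X = "\<lambda>x. E (F x) - F (E x) + (E (b x) - b (E x)) + (a (F x) - F (a x)) + (a (b x) - b (a x))"
  have X: "l (?X x) = ?X (l x)" for x
    unfolding E_F_expand by (simp add: endo_simps k_l k'_l)
  have "E (b x) - b (E x) + (a (b (l x)) - a (b (l x))) = a (F x) - F (a x)" for x
    using X[of x] by (simp add: endo_simps endo_ab_simps block_simps a_b_block_simps algebra_simps)
  then have *: "E (b x) - b (E x) = a (F x) - F (a x)" for x by simp
  have "l (E (b x) - b (E x)) = E (b x) - b (E x)" by (simp add: endo_simps block_simps)
  moreover have "l (a (F x) - F (a x)) = 0" by (simp add: endo_simps endo_ab_simps block_simps)
  ultimately have "E (b x) - b (E x) = 0" using * by metis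
  then show "E (b x) = b (E x)" "F (a x) = a (F x)" using *[of x] by simp_all
qed

lemma k_a: "k (a x) = t *s a (k x)" and k_b: "k (b x) = inverse t *s b (k x)"
  by (simp_all add: a_def b_def endo_simps k_e k_f k_l)

lemma k_E: "k (E x) = t *s E (k x)" and k_F: "k (F x) = inverse t *s F (k x)"
  by (simp_all add: E_def F_def endo_simps k_e k_f k_a k_b)

lemma k_nilpotent:
  assumes "endo scale T" "\<And>x. k (T x) = t *s T (k x)"
  shows "\<exists>N. \<forall>x. (T ^^ N) x = 0"
  using nilpotent_if_rescaled[OF assms(1) endo_k assms(2)] k_k' t_not_root v_nonzero
  by (metis power_not_zero)

lemma k'_nilpotent:
  assumes "endo scale T" "\<And>x. k (T x) = inverse t *s T (k x)"
  shows "\<exists>N. \<forall>x. (T ^^ N) x = 0"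
proof -
  have "k' (T x) = t *s T (k' x)" for x
  proof -
    have "k (t *s T (k' x)) = T x" using v_nonzero by (simp add: endo_simps assms(2) k_k')
    then show ?thesis by (metis k'_k)
  qed
  then show ?thesis
    using nilpotent_if_rescaled[OF assms(1) endo_k'] k'_k t_not_root v_nonzero
    by (metis power_not_zero)
qed

sublocale whole: quantum_triple scale e f k k' "\<lambda>x. x" t "inverse u"
proof
  show "t \<noteq> 0" "inverse u \<noteq> 0" using v_nonzero u_nonzero by simp_all
  show "t ^ n \<noteq> 1" if "n > 0" for n using t_not_root that .
  show "f (k x) = t *s k (f x)" for x using v_nonzero by (simp add: k_f)
  show "e (f x) = f (e x) + inverse u *s (k x - k' x)" for x using e_f[of x] by (simp add: algebra_simps)
  show "\<exists>N. \<forall>x. (e ^^ N) x = 0" using k_nilpotent[OF endo_e k_e] .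
  show "\<exists>N. \<forall>x. (f ^^ N) x = 0" using k'_nilpotent[OF endo_f k_f] .
qed (simp_all add: endo_simps k_k' k'_k k_e)

sublocale diagonal: quantum_triple scale E F k k' G t "inverse u"
proof
  show "t \<noteq> 0" "inverse u \<noteq> 0" using v_nonzero u_nonzero by simp_all
  show "t ^ n \<noteq> 1" if "n > 0" for n using t_not_root that .
  show "F (k x) = t *s k (F x)" for x using v_nonzero by (simp add: k_F)
  show "E (F x) = F (E x) + inverse u *s (k x - G (k' x))" for x
  proof -
    have "E (F x) - F (E x) = inverse u *s (k x - k' x) - (a (b x) - b (a x))"
      using E_F_expand[of x] by (simp add: E_b F_a algebra_simps)
    also have "\<dots> = inverse u *s (k x - G (k' x))"
    proof -
      have u: "inverse u *s u *s y = y" for y unfolding scale_scale left_inverse[OF u_nonzero] by (rule scale_one)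
      have "inverse u *s (y - (z + u *s w)) = inverse u *s (y - z) - w" for y z w
        by (simp only: diff_diff_add[symmetric] scale_right_diff_distrib[of "inverse u" _ "u *s w"] u)
      then show ?thesis by (simp only: G_def k_k')
    qed
    finally show ?thesis by (simp add: algebra_simps)
  qed
  show "\<exists>N. \<forall>x. (E ^^ N) x = 0" using k_nilpotent[OF endo_E k_E] .
  show "\<exists>N. \<forall>x. (F ^^ N) x = 0" using k'_nilpotent[OF endo_F k_F] .
  have t: "t \<noteq> 0" using v_nonzero by simp
  show "G (E x) = E (G x)" "G (F x) = F (G x)" "G (k x) = k (G x)" for x
    using t by (simp_all add: G_def endo_simps endo_ab_simps k_E k_F k_a k_b E_a E_b F_a F_b)
qed (simp_all add: module_hom.add[OF endo_E] module_hom.scale[OF endo_E] module_hom.add[OF endo_F]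
  module_hom.scale[OF endo_F] module_hom.add[OF endo_G] module_hom.scale[OF endo_G]
  endo_simps k_k' k'_k k_E)

section \<open>Simple invariant subspaces\<close>

text \<open>The strings of the untwisted triple \<open>e\<close>, \<open>f\<close>, \<open>k\<close> consist of eigenvectors of \<open>k\<close>, so \<open>k\<close> is
  diagonalizable.  This is the input that is needed for the twisted triple \<open>E\<close>, \<open>F\<close>, \<open>k\<close>, \<open>G\<close>.\<close>

lemma span_diagonal_strings: "span diagonal.strings = UNIV"
proof (rule diagonal.span_strings_if_K_diagonalizable)
  have "whole.strings \<subseteq> {x. \<exists>c. k x = c *s x}" using whole.strings_eigen(1) by blast
  moreover have "span whole.strings = UNIV"
    using whole.span_strings_if_G_id[of v] two_nonzero by simp
  ultimately show "span {x. \<exists>c. k x = c *s x} = UNIV" using span_mono by blast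
qed

definition block_hw_vector :: "'b \<Rightarrow> bool" where
  "block_hw_vector h \<longleftrightarrow> h \<noteq> 0 \<and> (\<exists>c g. diagonal.hw_vector c g h) \<and> (l h = h \<or> l h = 0)"

lemma span_block_strings: "span {(F ^^ n) h | n h. block_hw_vector h} = UNIV"
proof -
  let ?S = "{(F ^^ n) h | n h. block_hw_vector h}"
  have "s \<in> span ?S" if "s \<in> diagonal.strings" for s
  proof -
    obtain n c g h where h: "diagonal.hw_vector c g h" "s = (F ^^ n) h"
      using \<open>s \<in> diagonal.strings\<close> unfolding diagonal.strings_def by blast
    have Gl: "G (l x) = l (G x)" for x
      by (simp add: G_def endo_simps endo_ab_simps block_simps k_l)
    have "diagonal.hw_vector c g (l h)"
      using h(1) by (simp add: diagonal.hw_vector_def k_l Gl endo_simps block_simps(5)[symmetric])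
    moreover have "diagonal.hw_vector c g (h - l h)"
      using h(1) calculation
      by (simp add: diagonal.hw_vector_def endo_simps endo_ab_simps module_hom.diff[OF endo_G])
    ultimately have 1: "l h = 0 \<or> block_hw_vector (l h)" and 2: "h - l h = 0 \<or> block_hw_vector (h - l h)"
      unfolding block_hw_vector_def by (auto simp: l_l endo_simps)
    have Fn: "endo scale (F ^^ n)" by (rule endo_funpow[OF endo_F])
    have mem: "(F ^^ n) x \<in> span ?S" if "x = 0 \<or> block_hw_vector x" for x
      using that
    proof
      assume "x = 0"
      then show ?thesis by (simp add: module_hom.zero[OF Fn] span_zero)
    next
      assume "block_hw_vector x"
      then show ?thesis by (intro span_base) blast
    qed
    have "(F ^^ n) (l h + (h - l h)) \<in> span ?S"
      unfolding module_hom.add[OF Fn] by (rule span_add[OF mem[OF 1] mem[OF 2]])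
    moreover have "l h + (h - l h) = h" by simp
    ultimately show ?thesis by (simp only: h(2))
  qed
  then have "diagonal.strings \<subseteq> span ?S" by blast
  then show ?thesis using span_diagonal_strings span_minimal[OF _ subspace_span] by blast
qed

definition invariant :: "'b set \<Rightarrow> bool" where
  "invariant M \<longleftrightarrow> subspace M \<and> (\<forall>x\<in>M. e x \<in> M \<and> f x \<in> M \<and> k x \<in> M \<and> k' x \<in> M \<and> l x \<in> M)"

lemma invariant_mem:
  assumes "invariant U" "x \<in> U"
  shows "e x \<in> U" "f x \<in> U" "k x \<in> U" "k' x \<in> U" "l x \<in> U" "a x \<in> U" "b x \<in> U"
    "E x \<in> U" "F x \<in> U"
proof -
  have sub: "subspace U" and U: "\<And>x. x \<in> U \<Longrightarrow> e x \<in> U" "\<And>x. x \<in> U \<Longrightarrow> f x \<in> U"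
      "\<And>x. x \<in> U \<Longrightarrow> k x \<in> U" "\<And>x. x \<in> U \<Longrightarrow> k' x \<in> U" "\<And>x. x \<in> U \<Longrightarrow> l x \<in> U"
    using assms(1) by (auto simp: invariant_def)
  show "e x \<in> U" "f x \<in> U" "k x \<in> U" "k' x \<in> U" "l x \<in> U" using U assms(2) by auto
  show ab: "a x \<in> U" "b x \<in> U"
    unfolding a_def b_def using U assms(2) subspace_diff[OF sub] by auto
  show "E x \<in> U" "F x \<in> U"
    unfolding E_def F_def using U assms(2) ab subspace_diff[OF sub] by auto
qed

lemma invariant_funpow_mem:
  assumes "invariant U" "x \<in> U"
  shows "(E ^^ n) x \<in> U" "(F ^^ n) x \<in> U"
  using assms(2) by (induction n) (simp_all add: invariant_mem[OF assms(1)])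

definition string_span :: "'b \<Rightarrow> 'b set" where
  "string_span h = span (range (\<lambda>n. (F ^^ n) h))"

lemma string_span_mem:
  assumes h: "diagonal.hw_vector c g h" "h \<noteq> 0" and x: "x \<in> string_span h"
  shows "E x \<in> string_span h" "F x \<in> string_span h" "k x \<in> string_span h" "k' x \<in> string_span h"
    "G x = g *s x" "l h = h \<Longrightarrow> l x = x" "l h = 0 \<Longrightarrow> l x = 0"
proof -
  have base: "(F ^^ n) h \<in> string_span h" for n by (auto simp: string_span_def intro: span_base)
  have sub: "subspace (string_span h)" by (simp add: string_span_def)
  have *: "T x \<in> string_span h" if "endo scale T" "\<And>n. T ((F ^^ n) h) \<in> string_span h" for T
    by (rule endo_span_into[OF that(1) sub _ x[unfolded string_span_def]]) (use that(2) in auto)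
  have "E ((F ^^ n) h) \<in> string_span h" for n
  proof (cases n)
    case 0
    then show ?thesis using h(1) subspace_0[OF sub] by (simp add: diagonal.hw_vector_def)
  next
    case (Suc m)
    then show ?thesis
      using diagonal.E_hw_string[OF h, of m] subspace_scale[OF sub base] by metis
  qed
  with * endo_E show "E x \<in> string_span h" by blast
  have "F ((F ^^ n) h) \<in> string_span h" for n using base[of "Suc n"] by simp
  with * endo_F show "F x \<in> string_span h" by blast
  have k: "k ((F ^^ n) h) = (c / t ^ n) *s (F ^^ n) h" for n
    by (rule diagonal.K_hw_string[OF h(1)])
  then have "k ((F ^^ n) h) \<in> string_span h" for n
    using subspace_scale[OF sub base] by metis
  with * endo_k show "k x \<in> string_span h" by blast
  have "k' ((F ^^ n) h) \<in> string_span h" for n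
  proof (cases "(F ^^ n) h = 0")
    case True
    then show ?thesis using subspace_0[OF sub] by (simp add: endo_simps)
  next
    case False
    then show ?thesis
      using diagonal.K'_eigen[OF k] subspace_scale[OF sub base] by metis
  qed
  with * endo_k' show "k' x \<in> string_span h" by blast
  have eig: "T x = c *s x" if "endo scale T" "\<And>n. T ((F ^^ n) h) = c *s (F ^^ n) h" for T c
  proof (rule eigenvector_span[OF that(1)])
    have "{y \<in> range (\<lambda>n. (F ^^ n) h). T y = c *s y} = range (\<lambda>n. (F ^^ n) h)"
      using that(2) by auto
    then show "x \<in> span {y \<in> range (\<lambda>n. (F ^^ n) h). T y = c *s y}"
      using x by (simp add: string_span_def)
  qed
  show "G x = g *s x" by (rule eig[OF endo_G]) (rule diagonal.G_hw_string[OF h(1)])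
  have lF: "l ((F ^^ n) h) = (F ^^ n) (l h)" for n
    by (induction n) (simp_all add: block_simps)
  show "l x = x" if "l h = h" using eig[OF endo_l, of 1] by (simp add: lF that)
  show "l x = 0" if "l h = 0"
    using eig[OF endo_l, of 0] module_hom.zero[OF endo_funpow[OF endo_F]] by (simp add: lF that)
qed

text \<open>If \<open>G\<close> acts as \<open>1\<close>, a highest weight vector of weight \<open>c\<close> with \<open>c\<^sup>2 = t\<^sup>n\<close> has a string of length
  \<open>n + 1\<close>.  If \<open>a h\<close> were non-zero, it would be a highest weight vector of weight \<open>t c\<close>, with a string of
  length \<open>n + 3\<close>.  But \<open>a\<close> commutes with \<open>F\<close>, so this string is no longer than that of \<open>h\<close>.\<close>

lemma a_hw_vector_trivial:
  assumes h: "diagonal.hw_vector c 1 h" and z: "b (a (k h)) = 0"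
  shows "a h = 0"
proof (rule ccontr)
  assume ah: "a h \<noteq> 0"
  then have "h \<noteq> 0" using endo_ab_simps by auto
  have h': "E h = 0" "k h = c *s h" "G h = h" using h by (auto simp: diagonal.hw_vector_def)
  have ba: "b (a h) = 0"
    using z diagonal.weight_nonzero[OF h'(2) \<open>h \<noteq> 0\<close>] by (simp add: h' endo_ab_simps)
  have "diagonal.hw_vector (t * c) 1 (a h)"
    by (simp add: diagonal.hw_vector_def E_a k_a h' endo_ab_simps G_def a_a ba)
  from diagonal.hw_string_length[OF this ah]
  obtain m where m: "(t * c)\<^sup>2 = t ^ m * 1" "\<And>j. j \<le> m \<Longrightarrow> (F ^^ j) (a h) \<noteq> 0" by blast
  from diagonal.hw_string_length[OF h \<open>h \<noteq> 0\<close>]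
  obtain n where n: "c\<^sup>2 = t ^ n * 1" "(F ^^ Suc n) h = 0" by blast
  have "t ^ m = t ^ (n + 2)" using m(1) n(1) by (simp add: power_mult_distrib power_add mult.commute)
  then have "m = n + 2" by (rule diagonal.t_power_inj)
  have "(F ^^ j) (a x) = a ((F ^^ j) x)" for j x by (induction j) (simp_all add: F_a)
  then have "(F ^^ Suc n) (a h) = 0" using n(2) endo_ab_simps by metis
  with m(2)[of "Suc n"] \<open>m = n + 2\<close> show False by simp
qed

text \<open>If \<open>b h\<close> were non-zero, it would be a highest weight vector of weight \<open>c / t\<close> with a string of
  length \<open>n - 1\<close>.  As \<open>b\<close> and \<open>F\<close> commute up to a scalar, \<open>b\<close> kills \<open>F\<^sup>n\<^sup>-\<^sup>1 h\<close>.  But \<open>E\<close> commutes with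
  \<open>b\<close>, and powers of \<open>E\<close> bring \<open>F\<^sup>n\<^sup>-\<^sup>1 h\<close> back to a non-zero multiple of \<open>h\<close>, so \<open>b\<close> kills \<open>h\<close>.\<close>

lemma b_hw_vector_trivial:
  assumes h: "diagonal.hw_vector c 1 h" and z: "a (b (k h)) = 0"
  shows "b h = 0"
proof (rule ccontr)
  assume bh: "b h \<noteq> 0"
  then have "h \<noteq> 0" using endo_ab_simps by auto
  have h': "E h = 0" "k h = c *s h" "G h = h" using h by (auto simp: diagonal.hw_vector_def)
  have t: "t \<noteq> 0" using v_nonzero by simp
  have ab: "a (b h) = 0"
    using z diagonal.weight_nonzero[OF h'(2) \<open>h \<noteq> 0\<close>] by (simp add: h' endo_ab_simps)
  have "diagonal.hw_vector (inverse t * c) 1 (b h)"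
    by (simp add: diagonal.hw_vector_def E_b k_b h' endo_ab_simps G_def b_b ab)
  from diagonal.hw_string_length[OF this bh]
  obtain m where m: "(inverse t * c)\<^sup>2 = t ^ m * 1" "(F ^^ Suc m) (b h) = 0" by blast
  from diagonal.hw_string_length[OF h \<open>h \<noteq> 0\<close>]
  obtain n where n: "c\<^sup>2 = t ^ n * 1" by blast
  have "t ^ n = t\<^sup>2 * (inverse t * c)\<^sup>2" using n t by (simp add: power_mult_distrib power_inverse)
  also have "\<dots> = t ^ (m + 2)" unfolding m(1) by (simp add: power_add mult.commute)
  finally have "n = m + 2" by (rule diagonal.t_power_inj)
  have F_b_funpow: "(F ^^ j) (b x) = inverse t ^ j *s b ((F ^^ j) x)" for j x
    by (induction j) (simp_all add: F_b endo_ab_simps mult.commute)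
  have "inverse t ^ Suc m *s b ((F ^^ Suc m) h) = 0"
    using m(2) unfolding F_b_funpow .
  then have "b ((F ^^ Suc m) h) = 0"
    using t by (metis scale_eq_0_iff power_not_zero nonzero_imp_inverse_nonzero)
  moreover have "(E ^^ j) (b x) = b ((E ^^ j) x)" for j x by (induction j) (simp_all add: E_b)
  ultimately have "b ((E ^^ Suc m) ((F ^^ Suc m) h)) = 0"
    using module_hom.zero[OF endo_funpow[OF endo_E]] by metis
  moreover obtain c where "c \<noteq> 0" "(E ^^ Suc m) ((F ^^ Suc m) h) = c *s h"
    using diagonal.hw_string_up(1)[OF h \<open>h \<noteq> 0\<close> n, of "Suc m"] \<open>n = m + 2\<close> by auto
  ultimately show False using bh by (simp only: endo_ab_simps scale_eq_0_iff) simp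
qed

definition simple_invariant :: "'b set \<Rightarrow> bool" where
  "simple_invariant M \<longleftrightarrow>
    invariant M \<and> M \<noteq> {0} \<and> (\<forall>U. invariant U \<and> U \<subseteq> M \<longrightarrow> U = {0} \<or> U = M)"

text \<open>Let \<open>S\<close> be the span of a string in one of the two blocks, \<open>d\<close> the off-diagonal operator that leaves
  this block, and \<open>d'\<close> the one that returns to it; \<open>p\<close> tells whether the block is the image of \<open>\<ell>\<close>.
  Then \<open>S + d S\<close> is invariant since \<open>d\<close> commutes up to scalars with \<open>E\<close>, \<open>F\<close> and \<open>k\<close>.  It is simple: the
  idempotent \<open>\<ell>\<close> separates the two summands, a non-zero vector of \<open>S\<close> generates \<open>h\<close>, and \<open>d'\<close> maps a
  non-zero vector of \<open>d S\<close> to a non-zero vector of \<open>S\<close>, unless \<open>w = 0\<close>, where \<open>d S = 0\<close>.\<close>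

lemma simple_invariant_if_linked:
  assumes h: "diagonal.hw_vector c g h" "h \<noteq> 0"
    and dd': "(p \<and> d = a \<and> d' = b) \<or> (\<not> p \<and> d = b \<and> d' = a)"
    and l_S: "\<And>s. s \<in> string_span h \<Longrightarrow> l s = (if p then s else 0)"
    and d'_S: "\<And>s. s \<in> string_span h \<Longrightarrow> d' s = 0"
    and d'_d: "\<And>s. s \<in> string_span h \<Longrightarrow> d' (d s) = w *s k' s"
    and w: "w = 0 \<Longrightarrow> \<forall>s\<in>string_span h. d s = 0"
  shows "simple_invariant {s + d s' | s s'. s \<in> string_span h \<and> s' \<in> string_span h}"
    (is "simple_invariant ?M")
proof -
  let ?S = "string_span h"
  define M where "M = ?M"
  have d: "endo scale d" using dd' endo_a endo_b by auto
  note d_simps = module_hom.add[OF d] module_hom.scale[OF d] module_hom.zero[OF d]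
  have sub: "subspace ?S" by (simp add: string_span_def)
  have S: "x \<in> ?S \<Longrightarrow> E x \<in> ?S" "x \<in> ?S \<Longrightarrow> F x \<in> ?S" "x \<in> ?S \<Longrightarrow> k x \<in> ?S"
    "x \<in> ?S \<Longrightarrow> k' x \<in> ?S" for x
    using string_span_mem[OF h] by blast+
  have dd: "d (d x) = 0" for x using dd' a_a b_b by auto
  have Ed: "\<exists>c. \<forall>x. E (d x) = c *s d (E x)"
    using dd' E_a E_b by (auto intro: exI[of _ t] exI[of _ 1])
  have Fd: "\<exists>c. \<forall>x. F (d x) = c *s d (F x)"
    using dd' F_a F_b by (auto intro: exI[of _ "inverse t"] exI[of _ 1])
  have kd: "\<exists>c. \<forall>x. k (d x) = c *s d (k x)"
    using dd' k_a k_b by (auto intro: exI[of _ "inverse t"] exI[of _ t])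
  have k'd: "\<exists>c. \<forall>x. k' (d x) = c *s d (k' x)"
  proof -
    from kd obtain c where c: "\<And>x. k (d x) = c *s d (k x)" by blast
    have "c \<noteq> 0" if "d x \<noteq> 0" for x
      using c[of x] that by (metis k'_k endo_simps(16) scale_zero_left)
    then have "k' (d x) = inverse c *s d (k' x)" for x
      using c[of "k' x"] by (cases "d x = 0")
        (metis endo_simps k'_k k_k' scale_eq_0_iff scale_scale left_inverse scale_one)+
    then show ?thesis by blast
  qed
  have MI: "s + d s' \<in> M" if "s \<in> ?S" "s' \<in> ?S" for s s'
    using that unfolding M_def by blast
  have ME: "\<exists>s s'. x = s + d s' \<and> s \<in> ?S \<and> s' \<in> ?S" if "x \<in> M" for x
    using that unfolding M_def by blast
  have M: "subspace M"
  proof (rule subspaceI)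
    show "0 \<in> M" using MI[OF subspace_0[OF sub] subspace_0[OF sub]] by (simp add: d_simps)
  next
    fix x y assume "x \<in> M" "y \<in> M"
    with ME[of x] ME[of y] obtain x1 x2 y1 y2 where "x = x1 + d x2" "y = y1 + d y2"
        "x1 \<in> ?S" "x2 \<in> ?S" "y1 \<in> ?S" "y2 \<in> ?S"
      by blast
    then show "x + y \<in> M"
      using MI[of "x1 + y1" "x2 + y2"] subspace_add[OF sub] by (simp add: d_simps add.assoc add.left_commute)
  next
    fix c x assume "x \<in> M"
    with ME obtain x1 x2 where "x = x1 + d x2" "x1 \<in> ?S" "x2 \<in> ?S" by blast
    then show "c *s x \<in> M"
      using MI[of "c *s x1" "c *s x2"] subspace_scale[OF sub] by (simp add: d_simps scale_right_distrib)
  qed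
  have SM: "s \<in> M" if "s \<in> ?S" for s
    using MI[OF that subspace_0[OF sub]] by (simp add: d_simps)
  have dSM: "d s \<in> M" if "s \<in> ?S" for s
    using MI[OF subspace_0[OF sub] that] by simp
  have op: "T x \<in> M" if "endo scale T" "\<And>s. s \<in> ?S \<Longrightarrow> T s \<in> M" "\<And>s. s \<in> ?S \<Longrightarrow> T (d s) \<in> M"
      "x \<in> M" for T x
  proof -
    obtain s s' where "x = s + d s'" "s \<in> ?S" "s' \<in> ?S" using ME \<open>x \<in> M\<close> by blast
    then show ?thesis using that(2,3) subspace_add[OF M] by (simp add: module_hom.add[OF that(1)])
  qed
  have op': "T x \<in> M" if "endo scale T" "\<And>s. s \<in> ?S \<Longrightarrow> T s \<in> ?S" "\<exists>c. \<forall>x. T (d x) = c *s d (T x)"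
      "x \<in> M" for T x
  proof (rule op[OF that(1) _ _ that(4)])
    show "T s \<in> M" if "s \<in> ?S" for s using SM \<open>\<And>s. s \<in> ?S \<Longrightarrow> T s \<in> ?S\<close> that by blast
    show "T (d s) \<in> M" if "s \<in> ?S" for s
    proof -
      obtain c where "T (d s) = c *s d (T s)" using \<open>\<exists>c. \<forall>x. T (d x) = c *s d (T x)\<close> by blast
      then show ?thesis using \<open>\<And>s. s \<in> ?S \<Longrightarrow> T s \<in> ?S\<close> that dSM subspace_scale[OF M] by simp
    qed
  qed
  have MEx: "E x \<in> M" and MF: "F x \<in> M" and Mk: "k x \<in> M" and Mk': "k' x \<in> M"
    if "x \<in> M" for x
    using op'[OF endo_E _ Ed that] op'[OF endo_F _ Fd that] op'[OF endo_k _ kd that]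
      op'[OF endo_k' _ k'd that] S by blast+
  have Md: "d x \<in> M" if "x \<in> M" for x
    by (rule op[OF d _ _ that]) (use dSM dd subspace_0[OF M] in auto)
  have "endo scale d'" using dd' endo_a endo_b by auto
  then have Md': "d' x \<in> M" if "x \<in> M" for x
    by (rule op[OF _ _ _ that])
      (use d'_S d'_d subspace_0[OF M] subspace_scale[OF M] SM S(4) in auto)
  have Mab: "a x \<in> M" "b x \<in> M" if "x \<in> M" for x
    using Md[OF that] Md'[OF that] dd' by auto
  have ld: "l (d s) = (if p then 0 else d s)" for s
    using dd' block_simps by auto
  have Ml: "l x \<in> M" if "x \<in> M" for x
  proof (rule op[OF endo_l _ _ that])
    show "l s \<in> M" if "s \<in> ?S" for s
      unfolding l_S[OF that] using SM[OF that] subspace_0[OF M] by (cases p) (simp_all only: if_True if_False)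
    show "l (d s) \<in> M" if "s \<in> ?S" for s
      unfolding ld using dSM[OF that] subspace_0[OF M] by (cases p) (simp_all only: if_True if_False)
  qed
  have "e x \<in> M" "f x \<in> M" if "x \<in> M" for x
    using subspace_add[OF M MEx[OF that] Mab(1)[OF that]] subspace_add[OF M MF[OF that] Mab(2)[OF that]]
    by (simp_all only: e_eq[symmetric] f_eq[symmetric])
  then have inv: "invariant M" by (simp add: invariant_def M Mk Mk' Ml)
  have hS: "h \<in> ?S" unfolding string_span_def by (rule span_base) (auto intro: range_eqI[of _ _ 0])
  have "M \<subseteq> U" if U: "invariant U" "U \<subseteq> M" "U \<noteq> {0}" for U
  proof -
    have subU: "subspace U" using U(1) by (simp add: invariant_def)
    have gen: "h \<in> U" if s: "s \<in> ?S" "s \<noteq> 0" "s \<in> U" for s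
    proof -
      obtain j c where c: "c \<noteq> 0" "(E ^^ j) s = c *s h"
        using diagonal.hw_string_generates[OF h(1) s(1)[unfolded string_span_def] s(2)] by blast
      then have "inverse c *s (E ^^ j) s = h" by simp
      then show ?thesis using invariant_funpow_mem(1)[OF U(1) s(3)] subspace_scale[OF subU] by metis
    qed
    obtain y where y: "y \<in> U" "y \<noteq> 0" using U(3) subspace_0[OF subU] by blast
    then obtain s s' where s: "y = s + d s'" "s \<in> ?S" "s' \<in> ?S" using U(2) ME by blast
    have dU: "d x \<in> U" "d' x \<in> U" if "x \<in> U" for x
      using dd' invariant_mem(6,7)[OF U(1) that] by auto
    have "h \<in> U"
    proof (cases "s = 0")
      case False
      have "l y = (if p then s else d s')"
        using s l_S ld by (simp add: endo_simps)
      then have "s = (if p then l y else y - l y)" using s(1) by auto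
      then have "s \<in> U" using invariant_mem(5)[OF U(1) y(1)] y(1) subspace_diff[OF subU] by metis
      then show ?thesis using gen[OF s(2) False] by blast
    next
      case True
      then have ds: "y = d s'" using s by simp
      then have "w \<noteq> 0" using w y(2) s(3) by auto
      have "k (d' y) \<in> U" using invariant_mem(3)[OF U(1)] dU y(1) by blast
      then have "w *s s' \<in> U" using d'_d[OF s(3)] by (simp add: ds endo_simps k_k')
      then have "inverse w *s w *s s' \<in> U" by (rule subspace_scale[OF subU])
      then have "s' \<in> U" using \<open>w \<noteq> 0\<close> by simp
      moreover have "s' \<noteq> 0" using ds y(2) d_simps by auto
      ultimately show ?thesis using gen s(3) by blast
    qed
    then have "?S \<subseteq> U"
      unfolding string_span_def using invariant_funpow_mem(2)[OF U(1)]
      by (intro span_minimal[OF _ subU]) auto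
    then show ?thesis using dU(1) subspace_add[OF subU] ME by blast
  qed
  moreover have "M \<noteq> {0}" using SM[OF hS] h(2) by blast
  ultimately have "simple_invariant M" unfolding simple_invariant_def using inv by blast
  then show ?thesis unfolding M_def .
qed

text \<open>On the string of \<open>h\<close> the operator \<open>G\<close> is the scalar \<open>g\<close> and one of the two products \<open>a b\<close>, \<open>b a\<close>
  vanishes.  Hence the definition of \<open>G\<close> shows that the other product is a multiple of \<open>k\<^sup>-\<^sup>1\<close>, and that
  this multiple is zero only for \<open>g = 1\<close>.\<close>

lemma block_hw_vector_simple:
  assumes "block_hw_vector h"
  shows "\<exists>M. simple_invariant M \<and> (F ^^ n) h \<in> M"
proof -
  obtain c g where h: "diagonal.hw_vector c g h" "h \<noteq> 0" and lh: "l h = h \<or> l h = 0"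
    using assms by (auto simp: block_hw_vector_def)
  let ?S = "string_span h"
  note S = string_span_mem[OF h]
  have triv: "d s = 0" if "d = a \<or> d = b" "d h = 0" "s \<in> ?S" for d s
  proof -
    have "endo scale d" using that(1) endo_a endo_b by auto
    have Fj: "d ((F ^^ j) h) = 0" for j
    proof (induction j)
      case (Suc j)
      have "F (d x) = 0 \<Longrightarrow> d (F x) = 0" for x
        using that(1) F_a F_b v_nonzero by (auto simp: F_b)
      then show ?case using Suc by (simp add: endo_ab_simps)
    qed (simp add: that(2))
    have "d s \<in> {0}"
      by (rule endo_span_into[OF \<open>endo scale d\<close> subspace_single_0 _ that(3)[unfolded string_span_def]])
        (use Fj in auto)
    then show ?thesis by simp
  qed
  have Gs: "(g - 1) *s k' s = u *s (a (b s) - b (a s))" if "s \<in> ?S" for s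
    using S(5)[OF S(4)[OF that]] by (simp add: G_def k_k' scale_left_diff_distrib algebra_simps)
  have hS: "h \<in> ?S" unfolding string_span_def by (rule span_base) (auto intro: range_eqI[of _ _ 0])
  have 0: "0 \<in> ?S" by (simp add: string_span_def span_zero)
  have "\<exists>M. simple_invariant M \<and> ?S \<subseteq> M"
    using lh
  proof
    assume lh: "l h = h"
    have dS: "b s = 0" if "s \<in> ?S" for s
      using S(6)[OF that lh] block_simps(4)[of s] by (simp add: endo_ab_simps)
    have dd: "b (a s) = ((1 - g) / u) *s k' s" if "s \<in> ?S" for s
    proof -
      have "u *s b (a s) = (1 - g) *s k' s"
        using Gs[OF that] dS[OF that] by (simp add: endo_ab_simps scale_left_diff_distrib algebra_simps)
      then have "inverse u *s u *s b (a s) = inverse u *s (1 - g) *s k' s" by (rule arg_cong)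
      then show ?thesis
        unfolding scale_scale left_inverse[OF u_nonzero] scale_one by (simp only: divide_inverse mult.commute)
    qed
    have "a h = 0" if "(1 - g) / u = 0"
    proof -
      have "g = 1" using that u_nonzero by (simp only: divide_eq_0_iff) simp
      moreover have "b (a (k h)) = 0"
        using dd[OF S(3)[OF hS]] unfolding that by (simp only: scale_zero_left)
      ultimately show ?thesis using a_hw_vector_trivial h(1) by blast
    qed
    then have triv: "(1 - g) / u = 0 \<Longrightarrow> \<forall>s\<in>?S. a s = 0" using triv[of a] by blast
    have "simple_invariant {s + a s' | s s'. s \<in> ?S \<and> s' \<in> ?S}"
    proof (rule simple_invariant_if_linked[OF h, where p = True and d' = b and w = "(1 - g) / u"])
      show "l s = (if True then s else 0)" if "s \<in> ?S" for s using S(6)[OF that lh] by simp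
      show "(True \<and> a = a \<and> b = b) \<or> (\<not> True \<and> a = b \<and> b = a)" by simp
    qed (fact dS dd triv)+
    moreover have "?S \<subseteq> {s + a s' | s s'. s \<in> ?S \<and> s' \<in> ?S}"
    proof
      fix s assume "s \<in> ?S"
      moreover have "s = s + a 0" by (simp add: endo_ab_simps)
      ultimately show "s \<in> {s + a s' | s s'. s \<in> ?S \<and> s' \<in> ?S}" using 0 by blast
    qed
    ultimately show ?thesis by blast
  next
    assume lh: "l h = 0"
    have dS: "a s = 0" if "s \<in> ?S" for s
      using S(7)[OF that lh] block_simps(2)[of s] by (simp add: endo_ab_simps)
    have dd: "a (b s) = ((g - 1) / u) *s k' s" if "s \<in> ?S" for s
    proof -
      have "u *s a (b s) = (g - 1) *s k' s"
        using Gs[OF that] dS[OF that] by (simp add: endo_ab_simps scale_left_diff_distrib algebra_simps)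
      then have "inverse u *s u *s a (b s) = inverse u *s (g - 1) *s k' s" by (rule arg_cong)
      then show ?thesis
        unfolding scale_scale left_inverse[OF u_nonzero] scale_one by (simp only: divide_inverse mult.commute)
    qed
    have "b h = 0" if "(g - 1) / u = 0"
    proof -
      have "g = 1" using that u_nonzero by (simp only: divide_eq_0_iff) simp
      moreover have "a (b (k h)) = 0"
        using dd[OF S(3)[OF hS]] unfolding that by (simp only: scale_zero_left)
      ultimately show ?thesis using b_hw_vector_trivial h(1) by blast
    qed
    then have triv: "(g - 1) / u = 0 \<Longrightarrow> \<forall>s\<in>?S. b s = 0" using triv[of b] by blast
    have "simple_invariant {s + b s' | s s'. s \<in> ?S \<and> s' \<in> ?S}"
    proof (rule simple_invariant_if_linked[OF h, where p = False and d' = a and w = "(g - 1) / u"])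
      show "l s = (if False then s else 0)" if "s \<in> ?S" for s using S(7)[OF that lh] by simp
      show "(False \<and> b = a \<and> a = b) \<or> (\<not> False \<and> b = b \<and> a = a)" by simp
    qed (fact dS dd triv)+
    moreover have "?S \<subseteq> {s + b s' | s s'. s \<in> ?S \<and> s' \<in> ?S}"
    proof
      fix s assume "s \<in> ?S"
      moreover have "s = s + b 0" by (simp add: endo_ab_simps)
      ultimately show "s \<in> {s + b s' | s s'. s \<in> ?S \<and> s' \<in> ?S}" using 0 by blast
    qed
    ultimately show ?thesis by blast
  qed
  moreover have "(F ^^ n) h \<in> ?S" unfolding string_span_def by (rule span_base) blast
  ultimately show ?thesis by blast
qed

lemma span_simple_invariants: "span (\<Union> {M. simple_invariant M}) = UNIV"
proof -
  have "{(F ^^ n) h | n h. block_hw_vector h} \<subseteq> \<Union> {M. simple_invariant M}"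
    using block_hw_vector_simple by blast
  then show ?thesis using span_mono span_block_strings by blast
qed
end

section \<open>Direct sums of simple submodules\<close>

definition family_sum :: "nat \<Rightarrow> (nat \<Rightarrow> 'b::ab_group_add set) \<Rightarrow> 'b set" where
  "family_sum n W = {\<Sum>i<n. c i | c. \<forall>i<n. c i \<in> W i}"

definition independent_family :: "nat \<Rightarrow> (nat \<Rightarrow> 'b::ab_group_add set) \<Rightarrow> bool" where
  "independent_family n W \<longleftrightarrow> (\<forall>c. (\<forall>i<n. c i \<in> W i) \<and> (\<Sum>i<n. c i) = 0 \<longrightarrow> (\<forall>i<n. c i = 0))"

context left_module
begin

lemma act_0_right: "act r 0 = 0"
  using act_add_right[of r 0 0] by simp

lemma act_minus_1: "act (- 1) x = - x"
proof -
  have "act 0 x = 0" using act_add_left[of 0 0 x] by simp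
  then show ?thesis using act_add_left[of "- 1" 1 x] by (simp add: act_one eq_neg_iff_add_eq_0)
qed

lemma act_sum: "act r (sum g I) = (\<Sum>i\<in>I. act r (g i))"
  by (induction I rule: infinite_finite_induct) (simp_all add: act_add_right act_0_right)

lemma submodule_minus:
  assumes "submodule act M" "x \<in> M"
  shows "- x \<in> M"
  using assms act_minus_1[of x] unfolding submodule_def by metis

lemma submodule_diff:
  assumes "submodule act M" "x \<in> M" "y \<in> M"
  shows "x - y \<in> M"
  using assms submodule_minus[of M y] unfolding submodule_def by (metis diff_conv_add_uminus)

lemma submodule_family_sum:
  assumes "\<And>i. i < n \<Longrightarrow> submodule act (W i)"
  shows "submodule act (family_sum n W)"
  unfolding submodule_def
proof (intro conjI ballI allI)
  have "(\<Sum>i<n. 0) \<in> family_sum n W"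
    unfolding family_sum_def using assms by (intro CollectI exI[of _ "\<lambda>_. 0"]) (auto simp: submodule_def)
  then show "0 \<in> family_sum n W" by simp
next
  fix x y assume "x \<in> family_sum n W" "y \<in> family_sum n W"
  then obtain c d where cd: "x = (\<Sum>i<n. c i)" "y = (\<Sum>i<n. d i)" "\<forall>i<n. c i \<in> W i" "\<forall>i<n. d i \<in> W i"
    unfolding family_sum_def by blast
  then have "x + y = (\<Sum>i<n. c i + d i)" "\<forall>i<n. c i + d i \<in> W i"
    using assms by (auto simp: sum.distrib submodule_def)
  then show "x + y \<in> family_sum n W" unfolding family_sum_def by blast
next
  fix r x assume "x \<in> family_sum n W"
  then obtain c where c: "x = (\<Sum>i<n. c i)" "\<forall>i<n. c i \<in> W i"
    unfolding family_sum_def by blast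
  then have "act r x = (\<Sum>i<n. act r (c i))" "\<forall>i<n. act r (c i) \<in> W i"
    using assms by (auto simp: act_sum submodule_def)
  then show "act r x \<in> family_sum n W" unfolding family_sum_def by blast
qed

text \<open>Add the simple submodules one at a time.  A simple submodule meets the sum of the earlier ones in
  zero or is contained in it.\<close>

lemma direct_family_of_simples:
  assumes "finite B" "\<And>b. b \<in> B \<Longrightarrow> \<exists>M. simple_submodule act M \<and> b \<in> M"
  shows "\<exists>n W. (\<forall>i<n. simple_submodule act (W i)) \<and> independent_family n W \<and> B \<subseteq> family_sum n W"
  using assms
proof (induction B rule: finite_induct)
  case empty
  then show ?case by (intro exI[of _ 0]) (auto simp: independent_family_def)
next
  case (insert b B)
  then obtain n W where W: "\<And>i. i < n \<Longrightarrow> simple_submodule act (W i)" "independent_family n W"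
      "B \<subseteq> family_sum n W"
    by (metis insert_iff)
  from insert.prems obtain M where M: "simple_submodule act M" "b \<in> M" by blast
  show ?case
  proof (cases "b \<in> family_sum n W")
    case True
    then show ?thesis using W by (intro exI[of _ n] exI[of _ W]) auto
  next
    case False
    have sub: "submodule act (family_sum n W)"
      using W(1) by (intro submodule_family_sum) (auto simp: simple_submodule_def)
    have subM: "submodule act M" using M(1) by (simp add: simple_submodule_def)
    have "submodule act (M \<inter> family_sum n W)"
      using sub subM unfolding submodule_def by blast
    moreover have "M \<inter> family_sum n W \<noteq> M" using False M(2) by blast
    ultimately have disj: "M \<inter> family_sum n W = {0}"
      using M(1) unfolding simple_submodule_def by blast
    let ?W = "W(n := M)"
    have "\<forall>i<Suc n. simple_submodule act (?W i)" using W(1) M(1) by (simp add: less_Suc_eq)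
    moreover have "independent_family (Suc n) ?W"
      unfolding independent_family_def
    proof (intro allI impI)
      fix c i assume c: "(\<forall>i<Suc n. c i \<in> ?W i) \<and> (\<Sum>i<Suc n. c i) = 0" and i: "i < Suc n"
      then have cn: "c n \<in> M" and cW: "\<And>i. i < n \<Longrightarrow> c i \<in> W i" and s: "(\<Sum>i<n. c i) = - c n"
        by (auto simp: less_Suc_eq eq_neg_iff_add_eq_0)
      have "(\<Sum>i<n. c i) \<in> family_sum n W" using cW unfolding family_sum_def by blast
      then have "(\<Sum>i<n. c i) \<in> M \<inter> family_sum n W" using s submodule_minus[OF subM cn] by simp
      then have 0: "(\<Sum>i<n. c i) = 0" using disj by blast
      then have "c n = 0" using s by simp
      moreover have "c i = 0" if "i < n" for i
        using W(2) cW 0 that unfolding independent_family_def by blast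
      ultimately show "c i = 0" using i by (auto simp: less_Suc_eq)
    qed
    moreover have "insert b B \<subseteq> family_sum (Suc n) ?W"
    proof -
      have "b \<in> family_sum (Suc n) ?W"
        unfolding family_sum_def
      proof (intro CollectI exI conjI)
        let ?c = "\<lambda>i. if i = n then b else 0"
        show "b = (\<Sum>i<Suc n. ?c i)" by simp
        show "\<forall>i<Suc n. ?c i \<in> ?W i"
          using M(2) W(1) by (auto simp: less_Suc_eq simple_submodule_def submodule_def)
      qed
      moreover have "family_sum n W \<subseteq> family_sum (Suc n) ?W"
      proof
        fix x assume "x \<in> family_sum n W"
        then obtain c where c: "x = (\<Sum>i<n. c i)" "\<forall>i<n. c i \<in> W i"
          unfolding family_sum_def by blast
        have "x = (\<Sum>i<Suc n. (c(n := 0)) i)" 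
          unfolding c(1) sum.lessThan_Suc by simp
        moreover have "\<forall>i<Suc n. (c(n := 0)) i \<in> ?W i"
          using c(2) subM by (auto simp: less_Suc_eq submodule_def)
        ultimately show "x \<in> family_sum (Suc n) ?W" unfolding family_sum_def by blast
      qed
      ultimately show ?thesis using W(3) by blast
    qed
    ultimately show ?thesis by blast
  qed
qed

lemma is_direct_sum_family:
  assumes sub: "\<And>i. i < n \<Longrightarrow> submodule act (W i)"
    and ind: "independent_family n W" and all: "family_sum n W = UNIV"
  shows "is_direct_sum {..<n} W"
  unfolding is_direct_sum_def
proof (intro conjI allI)
  fix x
  have "x \<in> family_sum n W" using all by simp
  then obtain c where c: "x = (\<Sum>i<n. c i)" "\<forall>i<n. c i \<in> W i"
    unfolding family_sum_def by blast
  show "\<exists>!c. c \<in> (\<Pi>\<^sub>E i\<in>{..<n}. W i) \<and> x = (\<Sum>i<n. c i)"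
  proof (rule ex1I[of _ "restrict c {..<n}"])
    show "restrict c {..<n} \<in> (\<Pi>\<^sub>E i\<in>{..<n}. W i) \<and> x = (\<Sum>i<n. restrict c {..<n} i)"
      using c by auto
  next
    fix d assume d: "d \<in> (\<Pi>\<^sub>E i\<in>{..<n}. W i) \<and> x = (\<Sum>i<n. d i)"
    have "\<forall>i<n. d i - c i \<in> W i"
      using d c(2) submodule_diff[OF sub] by (auto simp: PiE_iff)
    moreover have "(\<Sum>i<n. d i - c i) = 0"
      by (simp only: sum_subtractf c(1)[symmetric] conjunct2[OF d, symmetric] diff_self)
    ultimately have "\<forall>i<n. d i - c i = 0"
      using ind[unfolded independent_family_def, THEN spec, of "\<lambda>i. d i - c i"] by blast
    then show "d = restrict c {..<n}"
      using d by (intro ext) (auto simp: PiE_iff extensional_def)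
  qed
qed simp

end

section \<open>Modules over the mirabolic algebra\<close>

lemma abs_MU_eq_if_mrel: "mrel x y \<Longrightarrow> abs_MU x = abs_MU y"
  by (simp add: MU.abs_eq_iff mcong_def mideal.rel)

lemma MU_rels:
  "MU_gen GK * MU_gen GKinv = 1"
  "MU_gen GKinv * MU_gen GK = 1"
  "MU_gen GK * MU_gen GE * MU_gen GKinv = MU_scalar (qv\<^sup>2) * MU_gen GE"
  "MU_gen GK * MU_gen GF * MU_gen GKinv = MU_scalar (inverse (qv\<^sup>2)) * MU_gen GF"
  "MU_gen GE * MU_gen GF - MU_gen GF * MU_gen GE
    = MU_scalar (inverse (qv - inverse qv)) * (MU_gen GK - MU_gen GKinv)"
  "MU_gen GL * MU_gen GL = MU_gen GL"
  "MU_gen GK * MU_gen GL = MU_gen GL * MU_gen GK"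
  "MU_gen GL * MU_gen GE * MU_gen GL = MU_gen GL * MU_gen GE"
  "MU_gen GL * MU_gen GF * MU_gen GL = MU_gen GF * MU_gen GL"
  "MU_scalar q2 * (MU_gen GE * MU_gen GL * MU_gen GE)
    = MU_scalar (inverse qv) * (MU_gen GE * MU_gen GE * MU_gen GL)
      + MU_scalar qv * (MU_gen GL * (MU_gen GE * MU_gen GE))"
  "MU_scalar q2 * (MU_gen GF * MU_gen GL * MU_gen GF)
    = MU_scalar (inverse qv) * (MU_gen GL * (MU_gen GF * MU_gen GF))
      + MU_scalar qv * (MU_gen GF * MU_gen GF * MU_gen GL)"
  unfolding MU_gen.abs_eq MU_scalar.abs_eq one_MU.abs_eq times_MU.abs_eq plus_MU.abs_eq minus_MU.abs_eq
  unfolding power2_eq_square[symmetric]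
  by (rule abs_MU_eq_if_mrel, rule mrel.intros)+

lemma MU_scalar_central: "MU_scalar c * x = x * MU_scalar c"
proof (transfer)
  fix c p
  have "fscalar c * p = p * fscalar c"
    by (induction p rule: mfree_induct)
      (simp_all add: fscalar_def distrib_left distrib_right mult_single mult.commute)
  then show "mcong (fscalar c * p) (p * fscalar c)" by (simp add: mcong_def mideal.zero)
qed

text \<open>The induction by which a subspace that is invariant under the generators is a submodule.\<close>

lemma MU_induct [case_names scalar gen add mult]:
  assumes "\<And>c. P (MU_scalar c)" "\<And>g. P (MU_gen g)"
    and "\<And>x y. P x \<Longrightarrow> P y \<Longrightarrow> P (x + y)" "\<And>x y. P x \<Longrightarrow> P y \<Longrightarrow> P (x * y)"
  shows "P x"
proof -
  have single: "P (abs_MU (Poly_Mapping.single (Word gs) c))" for gs c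
  proof (induction gs arbitrary: c)
    case Nil
    have "abs_MU (Poly_Mapping.single (Word []) c) = MU_scalar c"
      by (simp add: MU_scalar.abs_eq fscalar_def zero_mword_def)
    then show ?case using assms(1) by simp
  next
    case (Cons g gs)
    have "abs_MU (Poly_Mapping.single (Word (g # gs)) c)
        = MU_gen g * abs_MU (Poly_Mapping.single (Word gs) c)"
      by (simp add: MU_gen.abs_eq times_MU.abs_eq fgen_def mult_single)
    then show ?case using assms(2,4) Cons by simp
  qed
  have "P (abs_MU p)" for p
  proof (induction p rule: mfree_induct)
    case zero
    then show ?case using single[of "[]" 0] by simp
  next
    case (add p w c)
    obtain gs where "w = Word gs" by (cases w)
    then show ?case using assms(3)[OF add single[of gs c]] by (simp add: plus_MU.abs_eq)
  qed
  then show ?thesis by (rule MU.abs_induct)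
qed

lemma qv_power: "qv ^ n = Fract (monom 1 n) 1"
  by (induction n) (simp_all add: qv_def monom_0 monom_Suc One_fract_def flip: pCons_one)

lemma qv_not_root: "n > 0 \<Longrightarrow> qv ^ n \<noteq> 1"
proof
  assume n: "n > 0" and "qv ^ n = 1"
  then have "monom 1 n = (1 :: complex poly)"
    by (simp add: qv_power One_fract_def eq_fract)
  then have "degree (monom 1 n :: complex poly) = degree (1 :: complex poly)" by (rule arg_cong)
  then show False using n by (simp add: degree_monom_eq)
qed

lemma qv_nonzero: "qv \<noteq> 0"
  by (simp add: qv_def Zero_fract_def eq_fract)

lemma two_ratfun_nonzero: "(2 :: ratfun) \<noteq> 0"
proof -
  have "(2 :: ratfun) = Fract 1 1 + Fract 1 1" by (simp only: One_fract_def[symmetric] one_add_one)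
  also have "\<dots> = Fract 2 1" by simp
  also have "\<dots> \<noteq> Fract 0 1" by (subst eq_fract) simp_all
  finally show ?thesis by (simp only: Zero_fract_def not_False_eq_True)
qed

theorem theorem5p13:
  fixes act :: "MU \<Rightarrow> 'b::ab_group_add \<Rightarrow> 'b"
  assumes "left_module act"
    and "finite_dim act"
  shows "\<exists>(n::nat) W. (\<forall>i<n. simple_submodule act (W i)) \<and> is_direct_sum {..<n} W"
proof -
  interpret left_module act by (fact assms(1))
  let ?sc = "\<lambda>c. act (MU_scalar c)"
  obtain Bs where Bs: "finite_dimensional_vector_space ?sc Bs"
    using assms(2) by (auto simp: finite_dim_def)
  interpret V: finite_dimensional_vector_space ?sc Bs by (fact Bs)
  have endo: "endo ?sc (act r)" for r
    by unfold_locales (simp_all add: act_add_right act_act MU_scalar_central)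
  have rel: "act r x = act s x" if "r = s" for r s x using that by simp
  have act_diff: "act (r - s) x = act r x - act s x" for r s x
    using act_add_left[of "r - s" s x] by simp
  have KX: "MU_gen GK * MU_gen GE = MU_scalar (qv\<^sup>2) * (MU_gen GE * MU_gen GK)"
    "MU_gen GK * MU_gen GF = MU_scalar (inverse (qv\<^sup>2)) * (MU_gen GF * MU_gen GK)"
    using MU_rels(3,4)[THEN arg_cong, of "\<lambda>x. x * MU_gen GK"]
    by (simp_all add: mult.assoc MU_rels(2))
  interpret R: mirabolic_rep ?sc Bs "act (MU_gen GE)" "act (MU_gen GF)" "act (MU_gen GK)"
      "act (MU_gen GKinv)" "act (MU_gen GL)" qv
  proof
    fix x
    show "act (MU_gen GK) (act (MU_gen GKinv) x) = x" "act (MU_gen GKinv) (act (MU_gen GK) x) = x"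
      by (simp_all add: act_act MU_rels act_one)
    show "act (MU_gen GK) (act (MU_gen GE) x) = ?sc (qv\<^sup>2) (act (MU_gen GE) (act (MU_gen GK) x))"
      "act (MU_gen GK) (act (MU_gen GF) x) = ?sc (inverse (qv\<^sup>2)) (act (MU_gen GF) (act (MU_gen GK) x))"
      by (simp_all only: act_act KX)
    show "act (MU_gen GE) (act (MU_gen GF) x) - act (MU_gen GF) (act (MU_gen GE) x)
      = ?sc (inverse (qv - inverse qv)) (act (MU_gen GK) x - act (MU_gen GKinv) x)"
      by (simp only: act_act act_diff[symmetric] MU_rels)
    show "act (MU_gen GL) (act (MU_gen GL) x) = act (MU_gen GL) x"
      "act (MU_gen GK) (act (MU_gen GL) x) = act (MU_gen GL) (act (MU_gen GK) x)"
      by (simp_all only: act_act MU_rels)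
    show "act (MU_gen GL) (act (MU_gen GE) (act (MU_gen GL) x)) = act (MU_gen GL) (act (MU_gen GE) x)"
      "act (MU_gen GL) (act (MU_gen GF) (act (MU_gen GL) x)) = act (MU_gen GF) (act (MU_gen GL) x)"
      by (simp_all only: act_act mult.assoc[symmetric] MU_rels)
    show "?sc (qv + inverse qv) (act (MU_gen GE) (act (MU_gen GL) (act (MU_gen GE) x)))
      = ?sc (inverse qv) (act (MU_gen GE) (act (MU_gen GE) (act (MU_gen GL) x)))
        + ?sc qv (act (MU_gen GL) (act (MU_gen GE) (act (MU_gen GE) x)))"
      using rel[OF MU_rels(10), of x] by (simp only: act_add_left act_act mult.assoc q2_def)
    show "?sc (qv + inverse qv) (act (MU_gen GF) (act (MU_gen GL) (act (MU_gen GF) x)))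
      = ?sc (inverse qv) (act (MU_gen GL) (act (MU_gen GF) (act (MU_gen GF) x)))
        + ?sc qv (act (MU_gen GF) (act (MU_gen GF) (act (MU_gen GL) x)))"
      using rel[OF MU_rels(11), of x] by (simp only: act_add_left act_act mult.assoc q2_def)
    show "qv ^ n \<noteq> 1" if "n > 0" for n using qv_not_root[OF that] .
  qed (fact module_hom.add[OF endo] module_hom.scale[OF endo] qv_nonzero two_ratfun_nonzero)+
  have sub: "V.subspace M" if "submodule act M" for M
    using that by (auto simp: submodule_def V.subspace_def)
  have inv: "R.invariant M \<longleftrightarrow> submodule act M" for M
  proof
    assume "submodule act M"
    then show "R.invariant M" using sub by (auto simp: R.invariant_def submodule_def)
  next
    assume M: "R.invariant M"
    have gens: "act (MU_gen g) x \<in> M" if "x \<in> M" for g x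
      using M that by (cases g) (auto simp: R.invariant_def)
    have sub: "V.subspace M" using M by (simp add: R.invariant_def)
    have "\<forall>x\<in>M. act r x \<in> M" for r
    proof (induction r rule: MU_induct)
      case (scalar c)
      then show ?case using V.subspace_scale[OF sub] by blast
    next
      case (gen g)
      show ?case using gens by blast
    next
      case (add r s)
      then show ?case using V.subspace_add[OF sub] by (simp add: act_add_left)
    next
      case (mult r s)
      then show ?case by (simp flip: act_act)
    qed
    then show "submodule act M"
      using V.subspace_0[OF sub] V.subspace_add[OF sub] by (simp add: submodule_def)
  qed
  have simple: "R.simple_invariant M \<longleftrightarrow> simple_submodule act M" for M
    by (simp add: R.simple_invariant_def simple_submodule_def inv)
  obtain B where B: "B \<subseteq> \<Union> {M. R.simple_invariant M}" "V.independent B"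
      "\<Union> {M. R.simple_invariant M} \<subseteq> V.span B"
    using V.maximal_independent_subset by blast
  have "V.span B = UNIV"
    using R.span_simple_invariants V.span_minimal[OF B(3) V.subspace_span] by blast
  have "finite B" using B(2) by (rule V.finiteI_independent)
  moreover have "\<exists>M. simple_submodule act M \<and> b \<in> M" if "b \<in> B" for b
    using B(1) that simple by blast
  ultimately obtain n W where W: "\<forall>i<n. simple_submodule act (W i)" "independent_family n W"
      "B \<subseteq> family_sum n W"
    using direct_family_of_simples by metis
  have W': "submodule act (W i)" if "i < n" for i
    using W(1) that by (simp add: simple_submodule_def)
  have "V.span B \<subseteq> family_sum n W"
    by (intro V.span_minimal W(3) sub submodule_family_sum W')
  then have "family_sum n W = UNIV" using \<open>V.span B = UNIV\<close> by blast
  then have "is_direct_sum {..<n} W" using is_direct_sum_family[OF W' W(2)] by blast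
  with W(1) show ?thesis by blast
qed

end
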